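(* Let $k$ be an algebraically closed field, let $X$ be a scheme of finite type over $k$, and let $m\ge 1$ be an integer. Let $X_m$ be the $m$-jet scheme of $X$. Then: (i) if $X_m$ is reduced, then $X$ is reduced; (ii) if $X_m$ is connected, then $X$ is connected; (iii) if $X_m$ is irreducible, then $X$ is irreducible; (iv) if $X_m$ is locally integral, then $X$ is locally integral; (v) if $X_m$ is locally integral and normal, then $X$ is locally integral and normal.
   Context: For a scheme $X$ of finite type over $k$ and $m\ge 0$, the $m$-jet scheme $X_m$ is the scheme of finite type over $k$ characterized by a bijection, functorial in the $k$-scheme $Z$, $\operatorname{Hom}_k(Z,X_m)\simeq \operatorname{Hom}_k(Z\times_{\operatorname{Spec} k}\operatorname{Spec} k[t]/(t^{m+1}),X)$. A scheme is locally integral if all of its local rings are integral domains. *)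

theory Defs
  imports
    "HOL-Algebra.Algebraic_Closure"
    "HOL-Algebra.Generated_Rings"
    "HOL-Analysis.Abstract_Topology"
begin

(* frees the identifier X, used below for spaces *)
no_notation var (\<open>X\<index>\<close>)

section \<open>Commutative algebra\<close>

definition local_ring :: "'a ring \<Rightarrow> bool" where
  "local_ring R \<longleftrightarrow> cring R \<and> (\<exists>!M. maximalideal M R)"

definition local_hom :: "'a ring \<Rightarrow> 'b ring \<Rightarrow> ('a \<Rightarrow> 'b) \<Rightarrow> bool" where
  "local_hom R S h \<longleftrightarrow> h \<in> ring_hom R S \<and>
     (\<forall>M N. maximalideal M R \<and> maximalideal N S \<longrightarrow> h ` M \<subseteq> N)"

definition reduced_ring :: "'a ring \<Rightarrow> bool" where
  "reduced_ring R \<longleftrightarrow> cring R \<and>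
     (\<forall>a\<in>carrier R. \<forall>n::nat. a [^]\<^bsub>R\<^esub> n = \<zero>\<^bsub>R\<^esub> \<longrightarrow> a = \<zero>\<^bsub>R\<^esub>)"

text \<open>The fraction \<open>a / s\<close> in the localization of \<open>R\<close> at the multiplicative set \<open>S\<close>, as the
  equivalence class of the pair \<open>(a, s)\<close>.\<close>

definition frac :: "'a ring \<Rightarrow> 'a set \<Rightarrow> 'a \<Rightarrow> 'a \<Rightarrow> ('a \<times> 'a) set" where
  "frac R S a s = {(b, t). b \<in> carrier R \<and> t \<in> S \<and>
     (\<exists>u\<in>S. u \<otimes>\<^bsub>R\<^esub> ((t \<otimes>\<^bsub>R\<^esub> a) \<ominus>\<^bsub>R\<^esub> (s \<otimes>\<^bsub>R\<^esub> b)) = \<zero>\<^bsub>R\<^esub>)}"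

text \<open>Here and for stalks, an operation on classes is written as the union of the classes obtained
  from all representatives; as the operations are well defined, these classes all coincide.\<close>

definition localization :: "'a ring \<Rightarrow> 'a set \<Rightarrow> ('a \<times> 'a) set ring" where
  "localization R S = \<lparr>
     carrier = {frac R S a s | a s. a \<in> carrier R \<and> s \<in> S},
     monoid.mult = (\<lambda>A B. \<Union>(a, s)\<in>A. \<Union>(b, t)\<in>B. frac R S (a \<otimes>\<^bsub>R\<^esub> b) (s \<otimes>\<^bsub>R\<^esub> t)),
     one = frac R S \<one>\<^bsub>R\<^esub> \<one>\<^bsub>R\<^esub>,
     zero = frac R S \<zero>\<^bsub>R\<^esub> \<one>\<^bsub>R\<^esub>,
     add = (\<lambda>A B. \<Union>(a, s)\<in>A. \<Union>(b, t)\<in>B.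
              frac R S ((t \<otimes>\<^bsub>R\<^esub> a) \<oplus>\<^bsub>R\<^esub> (s \<otimes>\<^bsub>R\<^esub> b)) (s \<otimes>\<^bsub>R\<^esub> t))\<rparr>"

definition fraction_field :: "'a ring \<Rightarrow> ('a \<times> 'a) set ring" where
  "fraction_field R = localization R (carrier R - {\<zero>\<^bsub>R\<^esub>})"

definition to_fraction_field :: "'a ring \<Rightarrow> 'a \<Rightarrow> ('a \<times> 'a) set" where
  "to_fraction_field R a = frac R (carrier R - {\<zero>\<^bsub>R\<^esub>}) a \<one>\<^bsub>R\<^esub>"

text \<open>In HOL-Algebra a polynomial is the list of its coefficients, leading coefficient first;
  \<open>univ_poly L K\<close> consists of the polynomials with coefficients in the subring \<open>K\<close> of \<open>L\<close>.\<close>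

definition integral_over :: "'a ring \<Rightarrow> 'a set \<Rightarrow> 'a \<Rightarrow> bool" where
  "integral_over L K x \<longleftrightarrow> (\<exists>p\<in>carrier (univ_poly L K).
     p \<noteq> [] \<and> hd p = \<one>\<^bsub>L\<^esub> \<and> ring.eval L p x = \<zero>\<^bsub>L\<^esub>)"

definition normal_domain :: "'a ring \<Rightarrow> bool" where
  "normal_domain R \<longleftrightarrow> domain R \<and>
     (\<forall>x\<in>carrier (fraction_field R).
        integral_over (fraction_field R) (to_fraction_field R ` carrier R) x \<longrightarrow>
        x \<in> to_fraction_field R ` carrier R)"


section \<open>Locally ringed spaces\<close>

text \<open>\<open>sec X U\<close> is the ring of sections over \<open>U\<close> and \<open>res X U V\<close> the restriction from \<open>U\<close> to
  \<open>V \<subseteq> U\<close>; only their values at open sets matter.\<close>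

record ('p, 'r) rspace =
  space_of :: "'p topology"
  sec :: "'p set \<Rightarrow> 'r ring"
  res :: "'p set \<Rightarrow> 'p set \<Rightarrow> 'r \<Rightarrow> 'r"

abbreviation points :: "('p, 'r) rspace \<Rightarrow> 'p set" where
  "points X \<equiv> topspace (space_of X)"

abbreviation is_open :: "('p, 'r) rspace \<Rightarrow> 'p set \<Rightarrow> bool" where
  "is_open X U \<equiv> openin (space_of X) U"

locale ringed_space =
  fixes X :: "('p, 'r) rspace"
  assumes cring_sec: "is_open X U \<Longrightarrow> cring (sec X U)"
    and res_hom: "\<lbrakk>is_open X U; is_open X V; V \<subseteq> U\<rbrakk> \<Longrightarrow> res X U V \<in> ring_hom (sec X U) (sec X V)"
    and res_id: "\<lbrakk>is_open X U; s \<in> carrier (sec X U)\<rbrakk> \<Longrightarrow> res X U U s = s"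
    and res_comp: "\<lbrakk>is_open X U; is_open X V; is_open X W; W \<subseteq> V; V \<subseteq> U; s \<in> carrier (sec X U)\<rbrakk>
                    \<Longrightarrow> res X V W (res X U V s) = res X U W s"
    and gluing: "\<lbrakk>\<And>V. V \<in> \<V> \<Longrightarrow> is_open X V; \<And>V. V \<in> \<V> \<Longrightarrow> \<sigma> V \<in> carrier (sec X V);
                   \<And>V W. \<lbrakk>V \<in> \<V>; W \<in> \<V>\<rbrakk> \<Longrightarrow> res X V (V \<inter> W) (\<sigma> V) = res X W (V \<inter> W) (\<sigma> W)\<rbrakk>
                  \<Longrightarrow> \<exists>!t. t \<in> carrier (sec X (\<Union>\<V>)) \<and> (\<forall>V\<in>\<V>. res X (\<Union>\<V>) V t = \<sigma> V)"

definition germ :: "('p, 'r) rspace \<Rightarrow> 'p \<Rightarrow> 'p set \<Rightarrow> 'r \<Rightarrow> ('p set \<times> 'r) set" where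
  "germ X x U s = {(V, t). is_open X V \<and> x \<in> V \<and> t \<in> carrier (sec X V) \<and>
     (\<exists>W. is_open X W \<and> x \<in> W \<and> W \<subseteq> U \<inter> V \<and> res X U W s = res X V W t)}"

definition stalk :: "('p, 'r) rspace \<Rightarrow> 'p \<Rightarrow> ('p set \<times> 'r) set ring" where
  "stalk X x = \<lparr>
     carrier = {germ X x U s | U s. is_open X U \<and> x \<in> U \<and> s \<in> carrier (sec X U)},
     monoid.mult = (\<lambda>A B. \<Union>(U, s)\<in>A. \<Union>(V, t)\<in>B.
               germ X x (U \<inter> V) (res X U (U \<inter> V) s \<otimes>\<^bsub>sec X (U \<inter> V)\<^esub> res X V (U \<inter> V) t)),
     one = germ X x (points X) \<one>\<^bsub>sec X (points X)\<^esub>,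
     zero = germ X x (points X) \<zero>\<^bsub>sec X (points X)\<^esub>,
     add = (\<lambda>A B. \<Union>(U, s)\<in>A. \<Union>(V, t)\<in>B.
              germ X x (U \<inter> V) (res X U (U \<inter> V) s \<oplus>\<^bsub>sec X (U \<inter> V)\<^esub> res X V (U \<inter> V) t))\<rparr>"

locale locally_ringed_space = ringed_space +
  assumes local_stalks: "x \<in> points X \<Longrightarrow> local_ring (stalk X x)"

text \<open>A morphism \<open>f : X \<rightarrow> Y\<close> consists of a map of points and, for each open \<open>V\<close> of \<open>Y\<close>, a ring
  homomorphism \<open>comap f V\<close> from the sections of \<open>Y\<close> over \<open>V\<close> to the sections of \<open>X\<close> over the
  preimage of \<open>V\<close>. All these functions are extensional, so that equality in HOL is equality of
  morphisms.\<close>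

record ('p, 'r, 'q, 's) mor =
  base :: "'p \<Rightarrow> 'q"
  comap :: "'q set \<Rightarrow> 's \<Rightarrow> 'r"

definition preim :: "('p, 'r) rspace \<Rightarrow> ('p, 'r, 'q, 's) mor \<Rightarrow> 'q set \<Rightarrow> 'p set" where
  "preim X f V = {x \<in> points X. base f x \<in> V}"

definition stalk_map ::
  "('p, 'r) rspace \<Rightarrow> ('p, 'r, 'q, 's) mor \<Rightarrow> 'p \<Rightarrow> ('q set \<times> 's) set \<Rightarrow> ('p set \<times> 'r) set" where
  "stalk_map X f x A = (\<Union>(V, s)\<in>A. germ X x (preim X f V) (comap f V s))"

definition Mor :: "('p, 'r) rspace \<Rightarrow> ('q, 's) rspace \<Rightarrow> ('p, 'r, 'q, 's) mor set" where
  "Mor X Y = {f.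
     base f \<in> extensional (points X) \<and>
     comap f \<in> extensional {V. is_open Y V} \<and>
     (\<forall>V. is_open Y V \<longrightarrow> comap f V \<in> extensional (carrier (sec Y V))) \<and>
     continuous_map (space_of X) (space_of Y) (base f) \<and>
     (\<forall>V. is_open Y V \<longrightarrow> comap f V \<in> ring_hom (sec Y V) (sec X (preim X f V))) \<and>
     (\<forall>V W. is_open Y V \<and> is_open Y W \<and> W \<subseteq> V \<longrightarrow>
        (\<forall>s\<in>carrier (sec Y V).
           comap f W (res Y V W s) = res X (preim X f V) (preim X f W) (comap f V s))) \<and>
     (\<forall>x\<in>points X. local_hom (stalk Y (base f x)) (stalk X x) (stalk_map X f x))}"

definition id_mor :: "('p, 'r) rspace \<Rightarrow> ('p, 'r, 'p, 'r) mor" where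
  "id_mor X = \<lparr>base = (\<lambda>x\<in>points X. x),
               comap = (\<lambda>V\<in>{V. is_open X V}. \<lambda>s\<in>carrier (sec X V). s)\<rparr>"

definition comp_mor :: "('p, 'r) rspace \<Rightarrow> ('q, 's) rspace \<Rightarrow> ('o, 't) rspace \<Rightarrow>
    ('q, 's, 'o, 't) mor \<Rightarrow> ('p, 'r, 'q, 's) mor \<Rightarrow> ('p, 'r, 'o, 't) mor" where
  "comp_mor X Y Z g f = \<lparr>base = (\<lambda>x\<in>points X. base g (base f x)),
     comap = (\<lambda>V\<in>{V. is_open Z V}. \<lambda>s\<in>carrier (sec Z V). comap f (preim Y g V) (comap g V s))\<rparr>"

definition isomorphic :: "('p, 'r) rspace \<Rightarrow> ('q, 's) rspace \<Rightarrow> bool" where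
  "isomorphic X Y \<longleftrightarrow> (\<exists>f\<in>Mor X Y. \<exists>g\<in>Mor Y X.
     comp_mor X Y X g f = id_mor X \<and> comp_mor Y X Y f g = id_mor Y)"

definition open_subspace :: "('p, 'r) rspace \<Rightarrow> 'p set \<Rightarrow> ('p, 'r) rspace" where
  "open_subspace X U = \<lparr>space_of = subtopology (space_of X) U, sec = sec X, res = res X\<rparr>"


section \<open>Spectra\<close>

definition zariski_open :: "'a ring \<Rightarrow> 'a set \<Rightarrow> 'a set set" where
  "zariski_open R E = {P. primeideal P R \<and> \<not> E \<subseteq> P}"

definition zariski_topology :: "'a ring \<Rightarrow> 'a set topology" where
  "zariski_topology R = topology (\<lambda>U. \<exists>E\<subseteq>carrier R. U = zariski_open R E)"

lemma zariski_open_Int: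
  assumes "E \<subseteq> carrier R" "F \<subseteq> carrier R"
  shows "zariski_open R E \<inter> zariski_open R F =
         zariski_open R {e \<otimes>\<^bsub>R\<^esub> f | e f. e \<in> E \<and> f \<in> F}" (is "?L = ?R")
proof (intro equalityI subsetI)
  fix P assume "P \<in> ?L"
  then obtain e f where P: "primeideal P R" and ef: "e \<in> E" "e \<notin> P" "f \<in> F" "f \<notin> P"
    by (auto simp: zariski_open_def)
  have "e \<otimes>\<^bsub>R\<^esub> f \<notin> P"
    using primeideal.I_prime[OF P, of e f] ef assms by blast
  then show "P \<in> ?R" using P ef by (auto simp: zariski_open_def)
next
  fix P assume "P \<in> ?R"
  then obtain e f where P: "primeideal P R" and ef: "e \<in> E" "f \<in> F" "e \<otimes>\<^bsub>R\<^esub> f \<notin> P"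
    by (auto simp: zariski_open_def)
  interpret primeideal P R by (rule P)
  have "e \<notin> P" "f \<notin> P"
    using ef assms I_r_closed[of e f] I_l_closed[of f e] by blast+
  then show "P \<in> ?L" using P ef by (auto simp: zariski_open_def)
qed

lemma openin_zariski:
  "openin (zariski_topology R) U \<longleftrightarrow> (\<exists>E\<subseteq>carrier R. U = zariski_open R E)"
proof -
  let ?O = "\<lambda>U. \<exists>E\<subseteq>carrier R. U = zariski_open R E"
  have "?O (U \<inter> V)" if UV: "?O U" "?O V" for U V
  proof -
    obtain E F where EF: "E \<subseteq> carrier R" "U = zariski_open R E" "F \<subseteq> carrier R" "V = zariski_open R F"
      using UV by blast
    show ?thesis
    proof (cases "\<exists>P. primeideal P R")
      case True
      then obtain P where "primeideal P R" by blast
      then interpret primeideal P R .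
      have "{e \<otimes>\<^bsub>R\<^esub> f | e f. e \<in> E \<and> f \<in> F} \<subseteq> carrier R" using EF by blast
      then show ?thesis using zariski_open_Int[OF EF(1,3)] EF by blast
    next
      case False
      then have "U \<inter> V = zariski_open R {}" using EF by (auto simp: zariski_open_def)
      then show ?thesis by blast
    qed
  qed
  moreover have "?O (\<Union>\<K>)" if K: "\<forall>U\<in>\<K>. ?O U" for \<K>
  proof -
    obtain E where E: "\<forall>U\<in>\<K>. E U \<subseteq> carrier R \<and> U = zariski_open R (E U)" using K by metis
    then have "\<Union>\<K> = (\<Union>U\<in>\<K>. zariski_open R (E U))" by auto
    also have "\<dots> = zariski_open R (\<Union>U\<in>\<K>. E U)" by (auto simp: zariski_open_def)
    finally have "\<Union>\<K> = zariski_open R (\<Union>U\<in>\<K>. E U)" .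
    moreover have "(\<Union>U\<in>\<K>. E U) \<subseteq> carrier R" using E by blast
    ultimately show ?thesis by blast
  qed
  ultimately have "istopology ?O" unfolding istopology_def by blast
  then show ?thesis by (simp add: zariski_topology_def)
qed

text \<open>Sections over \<open>U\<close> are the families of elements of the local rings \<open>R\<^sub>P\<close>, \<open>P \<in> U\<close>, which
  locally are given by a single fraction.\<close>

definition spec_sections :: "'a ring \<Rightarrow> 'a set set \<Rightarrow> ('a set \<Rightarrow> ('a \<times> 'a) set) set" where
  "spec_sections R U =
     {\<sigma> \<in> (\<Pi>\<^sub>E P\<in>U. carrier (localization R (carrier R - P))).
        \<forall>P\<in>U. \<exists>V. openin (zariski_topology R) V \<and> P \<in> V \<and> V \<subseteq> U \<and>
          (\<exists>a\<in>carrier R. \<exists>f\<in>carrier R. \<forall>Q\<in>V. f \<notin> Q \<and> \<sigma> Q = frac R (carrier R - Q) a f)}"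

definition Spec :: "'a ring \<Rightarrow> ('a set, 'a set \<Rightarrow> ('a \<times> 'a) set) rspace" where
  "Spec R = \<lparr>space_of = zariski_topology R,
     sec = (\<lambda>U. \<lparr>carrier = spec_sections R U,
       monoid.mult = (\<lambda>\<sigma> \<tau>. \<lambda>P\<in>U. \<sigma> P \<otimes>\<^bsub>localization R (carrier R - P)\<^esub> \<tau> P),
       one = (\<lambda>P\<in>U. \<one>\<^bsub>localization R (carrier R - P)\<^esub>),
       zero = (\<lambda>P\<in>U. \<zero>\<^bsub>localization R (carrier R - P)\<^esub>),
       add = (\<lambda>\<sigma> \<tau>. \<lambda>P\<in>U. \<sigma> P \<oplus>\<^bsub>localization R (carrier R - P)\<^esub> \<tau> P)\<rparr>),
     res = (\<lambda>U V \<sigma>. restrict \<sigma> V)\<rparr>"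

definition Spec_map :: "'a ring \<Rightarrow> 'b ring \<Rightarrow> ('a \<Rightarrow> 'b) \<Rightarrow>
    ('b set, 'b set \<Rightarrow> ('b \<times> 'b) set, 'a set, 'a set \<Rightarrow> ('a \<times> 'a) set) mor" where
  "Spec_map R S h = \<lparr>
     base = (\<lambda>Q\<in>points (Spec S). {a \<in> carrier R. h a \<in> Q}),
     comap = (\<lambda>V\<in>{V. is_open (Spec R) V}. \<lambda>\<sigma>\<in>carrier (sec (Spec R) V).
       \<lambda>Q\<in>{Q \<in> points (Spec S). {a \<in> carrier R. h a \<in> Q} \<in> V}.
         \<Union>(a, s)\<in>\<sigma> {a \<in> carrier R. h a \<in> Q}. frac S (carrier S - Q) (h a) (h s))\<rparr>"


section \<open>Schemes\<close>

text \<open>If \<open>U\<close> is isomorphic to \<open>Spec R\<close>, then \<open>R\<close> is isomorphic to the ring of sections over \<open>U\<close>;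
  so it is no restriction that the elements of \<open>R\<close> have the same type as the sections.\<close>

definition affine_open :: "('p, 'r) rspace \<Rightarrow> 'p set \<Rightarrow> bool" where
  "affine_open X U \<longleftrightarrow> is_open X U \<and>
     (\<exists>R :: 'r ring. cring R \<and> isomorphic (open_subspace X U) (Spec R))"

definition scheme :: "('p, 'r) rspace \<Rightarrow> bool" where
  "scheme X \<longleftrightarrow> locally_ringed_space X \<and> (\<forall>x\<in>points X. \<exists>U. x \<in> U \<and> affine_open X U)"

definition finite_type_algebra :: "'a ring \<Rightarrow> 'b ring \<Rightarrow> ('a \<Rightarrow> 'b) \<Rightarrow> bool" where
  "finite_type_algebra R S h \<longleftrightarrow>
     (\<exists>F. finite F \<and> F \<subseteq> carrier S \<and> carrier S = generate_ring S (h ` carrier R \<union> F))"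

definition finite_type_mor ::
  "('p, 'r) rspace \<Rightarrow> ('q, 's) rspace \<Rightarrow> ('p, 'r, 'q, 's) mor \<Rightarrow> bool" where
  "finite_type_mor X Y f \<longleftrightarrow>
     (\<exists>\<V>. (\<forall>V\<in>\<V>. affine_open Y V) \<and> \<Union>\<V> = points Y \<and>
       (\<forall>V\<in>\<V>. \<exists>\<U>. finite \<U> \<and> (\<forall>U\<in>\<U>. affine_open X U) \<and> \<Union>\<U> = preim X f V \<and>
         (\<forall>U\<in>\<U>. finite_type_algebra (sec Y V) (sec X U)
                   (\<lambda>s. res X (preim X f V) U (comap f V s)))))"

definition fibre_product ::
  "('s, 't) rspace \<Rightarrow> ('p, 'r) rspace \<Rightarrow> ('p, 'r, 's, 't) mor \<Rightarrow>
   ('q, 'u) rspace \<Rightarrow> ('q, 'u, 's, 't) mor \<Rightarrow>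
   ('p, 'r) rspace \<Rightarrow> ('p, 'r, 'p, 'r) mor \<Rightarrow> ('p, 'r, 'q, 'u) mor \<Rightarrow> bool" where
  "fibre_product S Z a D b P p q \<longleftrightarrow>
     scheme P \<and> p \<in> Mor P Z \<and> q \<in> Mor P D \<and> comp_mor P Z S a p = comp_mor P D S b q \<and>
     (\<forall>(T :: ('p, 'r) rspace) u v.
        scheme T \<and> u \<in> Mor T Z \<and> v \<in> Mor T D \<and> comp_mor T Z S a u = comp_mor T D S b v \<longrightarrow>
        (\<exists>!h. h \<in> Mor T P \<and> comp_mor T P Z p h = u \<and> comp_mor T P D q h = v))"

text \<open>Irreducible and connected: an irreducible space is nonempty by definition, whereas
  the empty space counts as connected for the library's \<^const>\<open>connected_space\<close>.\<close>

definition irreducible_space :: "'p topology \<Rightarrow> bool" where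
  "irreducible_space T \<longleftrightarrow> topspace T \<noteq> {} \<and>
     (\<forall>A B. closedin T A \<and> closedin T B \<and> A \<union> B = topspace T \<longrightarrow> A = topspace T \<or> B = topspace T)"

definition reduced :: "('p, 'r) rspace \<Rightarrow> bool" where
  "reduced X \<longleftrightarrow> (\<forall>U. is_open X U \<longrightarrow> reduced_ring (sec X U))"

definition locally_integral :: "('p, 'r) rspace \<Rightarrow> bool" where
  "locally_integral X \<longleftrightarrow> (\<forall>x\<in>points X. domain (stalk X x))"

definition normal_scheme :: "('p, 'r) rspace \<Rightarrow> bool" where
  "normal_scheme X \<longleftrightarrow> (\<forall>x\<in>points X. normal_domain (stalk X x))"


section \<open>Schemes over a field and jet schemes\<close>

type_synonym ('p, 'r, 'k) over_Spec =
  "('p, 'r) rspace \<times> ('p, 'r, 'k set, 'k set \<Rightarrow> ('k \<times> 'k) set) mor"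

definition scheme_over :: "'k ring \<Rightarrow> ('p, 'r, 'k) over_Spec \<Rightarrow> bool" where
  "scheme_over k Z \<longleftrightarrow> scheme (fst Z) \<and> snd Z \<in> Mor (fst Z) (Spec k)"

definition finite_type_over :: "'k ring \<Rightarrow> ('p, 'r, 'k) over_Spec \<Rightarrow> bool" where
  "finite_type_over k Z \<longleftrightarrow> scheme_over k Z \<and> finite_type_mor (fst Z) (Spec k) (snd Z)"

definition Hom_over ::
  "'k ring \<Rightarrow> ('p, 'r, 'k) over_Spec \<Rightarrow> ('q, 's, 'k) over_Spec \<Rightarrow> ('p, 'r, 'q, 's) mor set" where
  "Hom_over k Z W =
     {f \<in> Mor (fst Z) (fst W). comp_mor (fst Z) (fst W) (Spec k) (snd W) f = snd Z}"

definition trunc_ideal :: "'k ring \<Rightarrow> nat \<Rightarrow> 'k list set" where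
  "trunc_ideal k m = PIdl\<^bsub>poly_ring k\<^esub> (var k [^]\<^bsub>poly_ring k\<^esub> Suc m)"

text \<open>The ring \<open>k[t]/(t\<^sup>m\<^sup>+\<^sup>1)\<close>.\<close>

definition trunc_ring :: "'k ring \<Rightarrow> nat \<Rightarrow> 'k list set ring" where
  "trunc_ring k m = poly_ring k Quot trunc_ideal k m"

definition trunc_const :: "'k ring \<Rightarrow> nat \<Rightarrow> 'k \<Rightarrow> 'k list set" where
  "trunc_const k m c = trunc_ideal k m +>\<^bsub>poly_ring k\<^esub> ring.poly_of_const k c"

definition trunc_Spec ::
  "'k ring \<Rightarrow> nat \<Rightarrow> ('k list set set, 'k list set set \<Rightarrow> ('k list set \<times> 'k list set) set, 'k) over_Spec"
  where
  "trunc_Spec k m = (Spec (trunc_ring k m), Spec_map k (trunc_ring k m) (trunc_const k m))"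

text \<open>\<open>P Z\<close>, with its projections \<open>p Z\<close> and \<open>q Z\<close>, is the fibre product
  \<open>Z \<times>\<^bsub>Spec k\<^esub> Spec k[t]/(t\<^sup>m\<^sup>+\<^sup>1)\<close>, which is determined up to unique isomorphism.

  The test schemes \<open>Z\<close> are those whose points and sections have the types of \<open>X\<close> and \<open>J\<close>; these
  types play the role of a universe. In a universe that contains a \<open>k\<close>-scheme \<open>Z\<close> the fibre product
  can be found as well, on the points of \<open>Z\<close> and with rings of sections isomorphic to
  \<open>O(U)[t]/(t\<^sup>m\<^sup>+\<^sup>1)\<close>, which for infinite \<open>k\<close> have the cardinality of \<open>O(U)\<close>.\<close>

definition jet_scheme ::
  "'k ring \<Rightarrow> nat \<Rightarrow> ('p, 'r, 'k) over_Spec \<Rightarrow> ('p, 'r, 'k) over_Spec \<Rightarrow> bool" where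
  "jet_scheme k m X J \<longleftrightarrow> finite_type_over k J \<and>
     (\<exists>(P :: ('p, 'r, 'k) over_Spec \<Rightarrow> ('p, 'r) rspace) p q
       (\<Phi> :: ('p, 'r, 'k) over_Spec \<Rightarrow> ('p, 'r, 'p, 'r) mor \<Rightarrow> ('p, 'r, 'p, 'r) mor).
        let prod = (\<lambda>Z. (P Z, comp_mor (P Z) (fst Z) (Spec k) (snd Z) (p Z))) in
        (\<forall>Z. scheme_over k Z \<longrightarrow>
           fibre_product (Spec k) (fst Z) (snd Z) (fst (trunc_Spec k m)) (snd (trunc_Spec k m))
             (P Z) (p Z) (q Z)) \<and>
        (\<forall>Z. scheme_over k Z \<longrightarrow> bij_betw (\<Phi> Z) (Hom_over k Z J) (Hom_over k (prod Z) X)) \<and>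
        (\<comment> \<open>naturality; \<open>h\<close> is the morphism \<open>g \<times> id\<close>\<close>
         \<forall>Z Z' g h u. scheme_over k Z \<and> scheme_over k Z' \<and> g \<in> Hom_over k Z' Z \<and>
             h \<in> Mor (P Z') (P Z) \<and>
             comp_mor (P Z') (P Z) (fst Z) (p Z) h = comp_mor (P Z') (fst Z') (fst Z) g (p Z') \<and>
             comp_mor (P Z') (P Z) (fst (trunc_Spec k m)) (q Z) h = q Z' \<and>
             u \<in> Hom_over k Z J \<longrightarrow>
           \<Phi> Z' (comp_mor (fst Z') (fst Z) (fst J) u g) =
             comp_mor (P Z') (P Z) (fst X) (\<Phi> Z u) h))"

end

theory Submission
  imports Defs
begin

text \<open>
  The scheme \<open>Y\<close> is a retract of its jet scheme \<open>J\<close>. Write \<open>D = Spec k[t]/(t\<^sup>m\<^sup>+\<^sup>1)\<close>. The projection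
  \<open>Y \<times> D \<rightarrow> Y\<close> corresponds to a morphism \<open>s : Y \<rightarrow> J\<close>, which sends a point to the constant jet there.
  Conversely the identity of \<open>J\<close> corresponds to the universal jet \<open>J \<times> D \<rightarrow> Y\<close>; composing it with the
  section \<open>J \<rightarrow> J \<times> D\<close> given by \<open>t \<mapsto> 0\<close> yields the morphism \<open>\<pi> : J \<rightarrow> Y\<close> that sends a jet to its
  base point. Naturality of the correspondence with respect to \<open>s\<close> gives \<open>\<pi> \<circ> s = id\<close>
  (lemma \<open>jet_retract\<close>).

  All five properties descend along a retraction. The map \<open>\<pi>\<close> is continuous and surjective, so
  connectedness and irreducibility pass from \<open>J\<close> to \<open>Y\<close>. The rings of sections and the local rings of
  \<open>Y\<close> are retracts of rings of sections and local rings of \<open>J\<close>. A retract \<open>A \<rightarrow> B \<rightarrow> A\<close> of a reduced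
  ring or of a domain has the same property, because \<open>A\<close> embeds in \<open>B\<close>; and if \<open>B\<close> is a normal domain,
  then a fraction \<open>a / s\<close> that is integral over \<open>A\<close> satisfies \<open>a = s c\<close> with \<open>c\<close> in \<open>B\<close>, and applying
  \<open>B \<rightarrow> A\<close> to this equation shows that \<open>a / s\<close> lies in \<open>A\<close> (lemma \<open>normal_retract\<close>).

  What remains is to see that the ingredients are morphisms: that locally ringed spaces form a
  category, and that \<open>Spec k \<rightarrow> D\<close>, \<open>t \<mapsto> 0\<close>, is a section of \<open>D \<rightarrow> Spec k\<close>. For a \<open>k\<close>-scheme \<open>Z\<close> the
  composite \<open>Z \<rightarrow> Spec k \<rightarrow> D\<close> is local on stalks because \<open>Spec k\<close> is a point with local ring \<open>k\<close>
  (lemma \<open>Mor_comp_Spec_map_field\<close>).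
\<close>

section \<open>Localization\<close>

lemma UN_pairs_const:
  assumes "p \<in> A" "\<And>a s. (a, s) \<in> A \<Longrightarrow> f a s = C"
  shows "(\<Union>(a, s)\<in>A. f a s) = C"
proof -
  have "(case q of (a, s) \<Rightarrow> f a s) = C" if "q \<in> A" for q
    using assms(2) that by (cases q) simp
  then show ?thesis using assms(1) by blast
qed

text \<open>As for the operations on classes, the union is over all representatives; for a homomorphism that
  respects the multiplicative sets these all yield the same class.\<close>

definition frac_map :: "'b ring \<Rightarrow> 'b set \<Rightarrow> ('a \<Rightarrow> 'b) \<Rightarrow> ('a \<times> 'a) set \<Rightarrow> ('b \<times> 'b) set" where
  "frac_map R T h x = (\<Union>(a, s)\<in>x. frac R T (h a) (h s))"

locale mult_subset = cring R for R :: "'a ring" (structure) +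
  fixes S :: "'a set"
  assumes S_sub: "S \<subseteq> carrier R" and one_S: "\<one> \<in> S"
    and mult_S: "\<lbrakk>s \<in> S; t \<in> S\<rbrakk> \<Longrightarrow> s \<otimes> t \<in> S"
begin

abbreviation "L \<equiv> localization R S"

lemma S_carrier: "s \<in> S \<Longrightarrow> s \<in> carrier R"
  using S_sub by blast

context notes S_carrier [simp, intro]
begin

lemma mem_frac:
  assumes "a \<in> carrier R" "s \<in> S"
  shows "(b, t) \<in> frac R S a s \<longleftrightarrow>
    b \<in> carrier R \<and> t \<in> S \<and> (\<exists>u\<in>S. u \<otimes> (t \<otimes> a) = u \<otimes> (s \<otimes> b))"
proof -
  have "u \<otimes> ((t \<otimes> a) \<ominus> (s \<otimes> b)) = \<zero> \<longleftrightarrow> u \<otimes> (t \<otimes> a) = u \<otimes> (s \<otimes> b)"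
    if "b \<in> carrier R" "t \<in> S" "u \<in> S" for u
  proof -
    have "u \<otimes> ((t \<otimes> a) \<ominus> (s \<otimes> b)) = u \<otimes> (t \<otimes> a) \<ominus> u \<otimes> (s \<otimes> b)"
      using that assms S_sub by (simp add: a_minus_def r_distr r_minus subsetD)
    then show ?thesis
      using that assms S_sub by (simp add: r_right_minus_eq subsetD)
  qed
  then show ?thesis by (auto simp: frac_def)
qed

lemma frac_self: "\<lbrakk>a \<in> carrier R; s \<in> S\<rbrakk> \<Longrightarrow> (a, s) \<in> frac R S a s"
  using one_S by (auto simp: mem_frac)

lemma frac_rel_trans:
  assumes "a \<in> carrier R" "b \<in> carrier R" "c \<in> carrier R" "s \<in> S" "t \<in> S" "r \<in> S"
    and "(b, t) \<in> frac R S a s" "(c, r) \<in> frac R S b t"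
  shows "(c, r) \<in> frac R S a s"
proof -
  obtain u v where u: "u \<in> S" "u \<otimes> (t \<otimes> a) = u \<otimes> (s \<otimes> b)"
    and v: "v \<in> S" "v \<otimes> (r \<otimes> b) = v \<otimes> (t \<otimes> c)"
    using assms by (auto simp: mem_frac)
  note c = assms(1-6) u(1) v(1)
  have "(u \<otimes> v \<otimes> t) \<otimes> (r \<otimes> a) = v \<otimes> r \<otimes> (u \<otimes> (t \<otimes> a))"
    using c by (simp add: m_ac)
  also have "\<dots> = u \<otimes> s \<otimes> (v \<otimes> (r \<otimes> b))"
    unfolding u(2) using c by (simp add: m_ac)
  also have "\<dots> = (u \<otimes> v \<otimes> t) \<otimes> (s \<otimes> c)"
    unfolding v(2) using c by (simp add: m_ac)
  finally show ?thesis
    using c mult_S by (auto simp: mem_frac)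
qed

lemma frac_sym:
  assumes "a \<in> carrier R" "s \<in> S" "(b, t) \<in> frac R S a s"
  shows "(a, s) \<in> frac R S b t"
  using assms by (metis mem_frac)

lemma frac_eq_iff_mem:
  assumes "a \<in> carrier R" "s \<in> S" "b \<in> carrier R" "t \<in> S"
  shows "frac R S a s = frac R S b t \<longleftrightarrow> (b, t) \<in> frac R S a s"
proof
  assume "frac R S a s = frac R S b t"
  then show "(b, t) \<in> frac R S a s" using assms frac_self by simp
next
  assume rel: "(b, t) \<in> frac R S a s"
  have "(c, r) \<in> frac R S a s \<longleftrightarrow> (c, r) \<in> frac R S b t" for c r
    using assms rel frac_sym frac_rel_trans by (metis mem_frac)
  then show "frac R S a s = frac R S b t" by auto
qed

lemma frac_eq_iff:
  assumes "a \<in> carrier R" "s \<in> S" "b \<in> carrier R" "t \<in> S"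
  shows "frac R S a s = frac R S b t \<longleftrightarrow> (\<exists>u\<in>S. u \<otimes> (t \<otimes> a) = u \<otimes> (s \<otimes> b))"
  using assms by (simp add: frac_eq_iff_mem mem_frac)

lemma frac_eqI:
  assumes "a \<in> carrier R" "s \<in> S" "b \<in> carrier R" "t \<in> S" "t \<otimes> a = s \<otimes> b"
  shows "frac R S a s = frac R S b t"
  using assms one_S by (auto simp: frac_eq_iff)

lemma frac_closed [simp, intro]:
  "\<lbrakk>a \<in> carrier R; s \<in> S\<rbrakk> \<Longrightarrow> frac R S a s \<in> carrier L"
  by (auto simp: localization_def)

lemma localizationE:
  assumes "x \<in> carrier L"
  obtains a s where "a \<in> carrier R" "s \<in> S" "x = frac R S a s"
  using assms by (auto simp: localization_def)

lemma frac_mult: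
  assumes "a \<in> carrier R" "s \<in> S" "b \<in> carrier R" "t \<in> S"
  shows "frac R S a s \<otimes>\<^bsub>L\<^esub> frac R S b t = frac R S (a \<otimes> b) (s \<otimes> t)"
proof -
  have "frac R S (a' \<otimes> b') (s' \<otimes> t') = frac R S (a \<otimes> b) (s \<otimes> t)"
    if rel: "(a', s') \<in> frac R S a s" "(b', t') \<in> frac R S b t" for a' s' b' t'
  proof -
    obtain u v where u: "u \<in> S" "u \<otimes> (s' \<otimes> a) = u \<otimes> (s \<otimes> a')"
      and v: "v \<in> S" "v \<otimes> (t' \<otimes> b) = v \<otimes> (t \<otimes> b')"
      and c': "a' \<in> carrier R" "s' \<in> S" "b' \<in> carrier R" "t' \<in> S"
      using assms rel by (auto simp: mem_frac)
    note c = assms c' u(1) v(1)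
    have "(u \<otimes> v) \<otimes> ((s \<otimes> t) \<otimes> (a' \<otimes> b')) = (u \<otimes> (s \<otimes> a')) \<otimes> (v \<otimes> (t \<otimes> b'))"
      using c by (simp add: m_ac)
    also have "\<dots> = (u \<otimes> v) \<otimes> ((s' \<otimes> t') \<otimes> (a \<otimes> b))"
      unfolding u(2)[symmetric] v(2)[symmetric] using c by (simp add: m_ac)
    finally show ?thesis using c mult_S by (subst frac_eq_iff) auto
  qed
  then have "(\<Union>(a', s')\<in>frac R S a s. \<Union>(b', t')\<in>frac R S b t. frac R S (a' \<otimes> b') (s' \<otimes> t'))
      = frac R S (a \<otimes> b) (s \<otimes> t)"
    using assms by (intro UN_pairs_const[OF frac_self] UN_pairs_const[OF frac_self]) auto
  then show ?thesis by (simp add: localization_def)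
qed

lemma frac_add:
  assumes "a \<in> carrier R" "s \<in> S" "b \<in> carrier R" "t \<in> S"
  shows "frac R S a s \<oplus>\<^bsub>L\<^esub> frac R S b t = frac R S (t \<otimes> a \<oplus> s \<otimes> b) (s \<otimes> t)"
proof -
  have "frac R S (t' \<otimes> a' \<oplus> s' \<otimes> b') (s' \<otimes> t') = frac R S (t \<otimes> a \<oplus> s \<otimes> b) (s \<otimes> t)"
    if rel: "(a', s') \<in> frac R S a s" "(b', t') \<in> frac R S b t" for a' s' b' t'
  proof -
    obtain u v where u: "u \<in> S" "u \<otimes> (s' \<otimes> a) = u \<otimes> (s \<otimes> a')"
      and v: "v \<in> S" "v \<otimes> (t' \<otimes> b) = v \<otimes> (t \<otimes> b')"
      and c': "a' \<in> carrier R" "s' \<in> S" "b' \<in> carrier R" "t' \<in> S"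
      using assms rel by (auto simp: mem_frac)
    note c = assms c' u(1) v(1)
    have "(u \<otimes> v) \<otimes> ((s \<otimes> t) \<otimes> (t' \<otimes> a' \<oplus> s' \<otimes> b'))
        = (v \<otimes> t \<otimes> t') \<otimes> (u \<otimes> (s \<otimes> a')) \<oplus> (u \<otimes> s \<otimes> s') \<otimes> (v \<otimes> (t \<otimes> b'))"
      using c by (simp add: m_ac r_distr)
    also have "\<dots> = (u \<otimes> v) \<otimes> ((s' \<otimes> t') \<otimes> (t \<otimes> a \<oplus> s \<otimes> b))"
      unfolding u(2)[symmetric] v(2)[symmetric] using c by (simp add: m_ac r_distr)
    finally show ?thesis using c mult_S by (subst frac_eq_iff) auto
  qed
  then have "(\<Union>(a', s')\<in>frac R S a s. \<Union>(b', t')\<in>frac R S b t.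
        frac R S (t' \<otimes> a' \<oplus> s' \<otimes> b') (s' \<otimes> t')) = frac R S (t \<otimes> a \<oplus> s \<otimes> b) (s \<otimes> t)"
    using assms by (intro UN_pairs_const[OF frac_self] UN_pairs_const[OF frac_self]) auto
  then show ?thesis by (simp add: localization_def)
qed

lemma localization_one: "\<one>\<^bsub>L\<^esub> = frac R S \<one> \<one>"
  and localization_zero: "\<zero>\<^bsub>L\<^esub> = frac R S \<zero> \<one>"
  by (simp_all add: localization_def)

lemma frac_zero: "s \<in> S \<Longrightarrow> frac R S \<zero> s = \<zero>\<^bsub>L\<^esub>"
  unfolding localization_zero using one_S by (intro frac_eqI) auto

lemma frac_l_neg:
  assumes "a \<in> carrier R" "s \<in> S"
  shows "frac R S (\<ominus> \<one>) \<one> \<otimes>\<^bsub>L\<^esub> frac R S a s \<oplus>\<^bsub>L\<^esub> frac R S a s = \<zero>\<^bsub>L\<^esub>"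
  using assms one_S mult_S
  by (simp add: frac_mult frac_add l_minus r_minus l_neg frac_zero)

lemma cring_localization: "cring L"
proof (rule cringI)
  show "abelian_group L"
  proof (rule abelian_groupI)
    fix x y assume "x \<in> carrier L" "y \<in> carrier L"
    then obtain a s b t where xy: "a \<in> carrier R" "s \<in> S" "x = frac R S a s"
      "b \<in> carrier R" "t \<in> S" "y = frac R S b t" by (metis localizationE)
    show "x \<oplus>\<^bsub>L\<^esub> y \<in> carrier L" using xy mult_S by (simp add: frac_add)
    show "x \<oplus>\<^bsub>L\<^esub> y = y \<oplus>\<^bsub>L\<^esub> x"
      using xy mult_S by (simp add: frac_add m_comm a_comm)
    fix z assume "z \<in> carrier L"
    then obtain c r where z: "c \<in> carrier R" "r \<in> S" "z = frac R S c r" by (metis localizationE)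
    show "(x \<oplus>\<^bsub>L\<^esub> y) \<oplus>\<^bsub>L\<^esub> z = x \<oplus>\<^bsub>L\<^esub> (y \<oplus>\<^bsub>L\<^esub> z)"
      using xy z mult_S by (simp add: frac_add r_distr l_distr m_ac a_ac)
  next
    show "\<zero>\<^bsub>L\<^esub> \<in> carrier L" using one_S by (simp add: localization_zero)
  next
    fix x assume "x \<in> carrier L"
    then obtain a s where x: "a \<in> carrier R" "s \<in> S" "x = frac R S a s" by (metis localizationE)
    show "\<zero>\<^bsub>L\<^esub> \<oplus>\<^bsub>L\<^esub> x = x"
      using x mult_S one_S by (simp add: localization_zero frac_add)
    have "frac R S (\<ominus> \<one>) \<one> \<otimes>\<^bsub>L\<^esub> x \<in> carrier L"
      using x mult_S one_S by (simp add: frac_mult)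
    then show "\<exists>y\<in>carrier L. y \<oplus>\<^bsub>L\<^esub> x = \<zero>\<^bsub>L\<^esub>"
      unfolding x(3) using frac_l_neg[OF x(1,2)] by blast
  qed
  show "comm_monoid L"
  proof (rule comm_monoidI)
    show "\<one>\<^bsub>L\<^esub> \<in> carrier L" using one_S by (simp add: localization_one)
  next
    fix x y assume "x \<in> carrier L" "y \<in> carrier L"
    then obtain a s b t where xy: "a \<in> carrier R" "s \<in> S" "x = frac R S a s"
      "b \<in> carrier R" "t \<in> S" "y = frac R S b t" by (metis localizationE)
    show "x \<otimes>\<^bsub>L\<^esub> y \<in> carrier L" using xy mult_S by (simp add: frac_mult)
    show "x \<otimes>\<^bsub>L\<^esub> y = y \<otimes>\<^bsub>L\<^esub> x" using xy mult_S by (simp add: frac_mult m_comm)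
    show "\<one>\<^bsub>L\<^esub> \<otimes>\<^bsub>L\<^esub> x = x" using xy one_S by (simp add: frac_mult localization_one)
    fix z assume "z \<in> carrier L"
    then obtain c r where z: "c \<in> carrier R" "r \<in> S" "z = frac R S c r" by (metis localizationE)
    show "(x \<otimes>\<^bsub>L\<^esub> y) \<otimes>\<^bsub>L\<^esub> z = x \<otimes>\<^bsub>L\<^esub> (y \<otimes>\<^bsub>L\<^esub> z)"
      using xy z mult_S by (simp add: frac_mult m_ac)
  qed
  fix x y z assume "x \<in> carrier L" "y \<in> carrier L" "z \<in> carrier L"
  then obtain a s b t c r where xyz: "a \<in> carrier R" "s \<in> S" "x = frac R S a s"
    "b \<in> carrier R" "t \<in> S" "y = frac R S b t"
    "c \<in> carrier R" "r \<in> S" "z = frac R S c r" by (metis localizationE)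
  then show "(x \<oplus>\<^bsub>L\<^esub> y) \<otimes>\<^bsub>L\<^esub> z = x \<otimes>\<^bsub>L\<^esub> z \<oplus>\<^bsub>L\<^esub> y \<otimes>\<^bsub>L\<^esub> z"
    using mult_S by (simp add: frac_mult frac_add, intro frac_eqI)
      (simp_all add: l_distr r_distr m_ac a_ac)
qed

lemma frac_map_frac:
  assumes "mult_subset R' T" and h: "h \<in> ring_hom R R'" and hS: "h ` S \<subseteq> T"
    and as: "a \<in> carrier R" "s \<in> S"
  shows "frac_map R' T h (frac R S a s) = frac R' T (h a) (h s)"
proof -
  interpret T: mult_subset R' T by fact
  show ?thesis
    unfolding frac_map_def
  proof (rule UN_pairs_const[OF frac_self[OF as]])
    fix b t assume "(b, t) \<in> frac R S a s"
    then obtain u where u: "u \<in> S" "u \<otimes> (t \<otimes> a) = u \<otimes> (s \<otimes> b)"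
      and c: "b \<in> carrier R" "t \<in> S" using as by (auto simp: mem_frac)
    have "h (u \<otimes> (t \<otimes> a)) = h (u \<otimes> (s \<otimes> b))" using u by simp
    then have "h u \<otimes>\<^bsub>R'\<^esub> (h t \<otimes>\<^bsub>R'\<^esub> h a) = h u \<otimes>\<^bsub>R'\<^esub> (h s \<otimes>\<^bsub>R'\<^esub> h b)"
      using u(1) c as by (simp add: ring_hom_mult[OF h])
    then show "frac R' T (h b) (h t) = frac R' T (h a) (h s)"
      using u(1) c as hS ring_hom_closed[OF h] by (subst T.frac_eq_iff) force+
  qed
qed

lemma frac_map_hom:
  assumes T: "mult_subset R' T" and h: "h \<in> ring_hom R R'" and hS: "h ` S \<subseteq> T"
  shows "frac_map R' T h \<in> ring_hom L (localization R' T)"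
proof -
  interpret T: mult_subset R' T by fact
  note map = frac_map_frac[OF assms]
  have hS': "h s \<in> T" if "s \<in> S" for s using hS that by blast
  show ?thesis
  proof (rule ring_hom_memI)
    fix x assume "x \<in> carrier L"
    then obtain a s where "a \<in> carrier R" "s \<in> S" "x = frac R S a s" by (metis localizationE)
    then show "frac_map R' T h x \<in> carrier (localization R' T)"
      using ring_hom_closed[OF h, of a] hS' by (simp add: map)
  next
    fix x y assume "x \<in> carrier L" "y \<in> carrier L"
    then obtain a s b t where xy: "a \<in> carrier R" "s \<in> S" "x = frac R S a s"
      "b \<in> carrier R" "t \<in> S" "y = frac R S b t" by (metis localizationE)
    then show "frac_map R' T h (x \<otimes>\<^bsub>L\<^esub> y) =
        frac_map R' T h x \<otimes>\<^bsub>localization R' T\<^esub> frac_map R' T h y"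
      and "frac_map R' T h (x \<oplus>\<^bsub>L\<^esub> y) =
        frac_map R' T h x \<oplus>\<^bsub>localization R' T\<^esub> frac_map R' T h y"
      using ring_hom_closed[OF h, of a] ring_hom_closed[OF h, of b]
      by (simp_all add: map hS' mult_S frac_mult frac_add T.frac_mult T.frac_add
          ring_hom_mult[OF h] ring_hom_add[OF h])
  next
    show "frac_map R' T h \<one>\<^bsub>L\<^esub> = \<one>\<^bsub>localization R' T\<^esub>"
      using one_S by (simp add: localization_one T.localization_one map ring_hom_one[OF h])
  qed
qed

end

end

section \<open>Presheaves of rings and their morphisms\<close>

text \<open>Stalks and composites of morphisms depend on restriction only, so schemes and \<open>Spec R\<close> can be treated
  alike at the level of presheaves.\<close>

locale ring_presheaf =
  fixes X :: "('p, 'r) rspace"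
  assumes cring_sec: "is_open X U \<Longrightarrow> cring (sec X U)"
    and res_hom: "\<lbrakk>is_open X U; is_open X V; V \<subseteq> U\<rbrakk> \<Longrightarrow> res X U V \<in> ring_hom (sec X U) (sec X V)"
    and res_id: "\<lbrakk>is_open X U; s \<in> carrier (sec X U)\<rbrakk> \<Longrightarrow> res X U U s = s"
    and res_comp: "\<lbrakk>is_open X U; is_open X V; is_open X W; W \<subseteq> V; V \<subseteq> U; s \<in> carrier (sec X U)\<rbrakk>
                    \<Longrightarrow> res X V W (res X U V s) = res X U W s"

sublocale ringed_space \<subseteq> ring_presheaf
  by (rule ring_presheaf.intro) (fact cring_sec res_hom res_id res_comp)+

context ring_presheaf
begin

lemma res_closed:
  "\<lbrakk>is_open X U; is_open X V; V \<subseteq> U; s \<in> carrier (sec X U)\<rbrakk> \<Longrightarrow> res X U V s \<in> carrier (sec X V)"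
  using res_hom ring_hom_closed by metis

lemma germ_self: "\<lbrakk>is_open X U; x \<in> U; s \<in> carrier (sec X U)\<rbrakk> \<Longrightarrow> (U, s) \<in> germ X x U s"
  by (auto simp: germ_def)

lemma germ_rel_trans:
  assumes "is_open X U" "s \<in> carrier (sec X U)"
    and "(V, t) \<in> germ X x U s" "(V', t') \<in> germ X x V t"
  shows "(V', t') \<in> germ X x U s"
proof -
  obtain W where W: "is_open X W" "x \<in> W" "W \<subseteq> U \<inter> V" "res X U W s = res X V W t"
    and V: "is_open X V" "t \<in> carrier (sec X V)"
    using assms by (auto simp: germ_def)
  obtain W' where W': "is_open X W'" "x \<in> W'" "W' \<subseteq> V \<inter> V'" "res X V W' t = res X V' W' t'"
    and V': "is_open X V'" "x \<in> V'" "t' \<in> carrier (sec X V')"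
    using assms by (auto simp: germ_def)
  let ?W = "W \<inter> W'"
  have "res X U ?W s = res X W ?W (res X U W s)"
    using W W' assms by (subst res_comp) auto
  also have "\<dots> = res X W' ?W (res X V W' t)"
    unfolding W(4) using W W' V by (subst (1 2) res_comp) auto
  also have "\<dots> = res X V' ?W t'"
    unfolding W'(4) using W W' V' by (subst res_comp) auto
  finally have "res X U ?W s = res X V' ?W t'" .
  moreover have "is_open X ?W" "x \<in> ?W" "?W \<subseteq> U \<inter> V'" using W W' by auto
  ultimately show ?thesis using V' unfolding germ_def by blast
qed

lemma germ_sym:
  assumes "is_open X U" "x \<in> U" "s \<in> carrier (sec X U)" "(V, t) \<in> germ X x U s"
  shows "(U, s) \<in> germ X x V t"
  using assms unfolding germ_def by (auto simp: Int_commute)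

lemma germ_eqD:
  assumes "is_open X U" "x \<in> U" "s \<in> carrier (sec X U)" "(V, t) \<in> germ X x U s"
  shows "germ X x V t = germ X x U s"
proof -
  have V: "is_open X V" "t \<in> carrier (sec X V)" using assms(4) by (auto simp: germ_def)
  have "p \<in> germ X x V t \<longleftrightarrow> p \<in> germ X x U s" for p
    using germ_rel_trans[OF assms(1,3,4)] germ_rel_trans[OF V germ_sym[OF assms]] by (cases p) blast
  then show ?thesis by blast
qed

lemma germ_eqI:
  assumes "is_open X U" "is_open X V" "is_open X W" "x \<in> W" "W \<subseteq> U" "W \<subseteq> V"
    "s \<in> carrier (sec X U)" "t \<in> carrier (sec X V)" "res X U W s = res X V W t"
  shows "germ X x U s = germ X x V t"
proof -
  have "x \<in> U" "(V, t) \<in> germ X x U s" using assms by (auto simp: germ_def)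
  then show ?thesis using germ_eqD assms by metis
qed

lemma germ_res:
  assumes "is_open X U" "is_open X W" "x \<in> W" "W \<subseteq> U" "s \<in> carrier (sec X U)"
  shows "germ X x W (res X U W s) = germ X x U s"
  using assms by (intro germ_eqI[where W = W]) (auto simp: res_closed res_id)

lemma germ_closed:
  "\<lbrakk>is_open X U; x \<in> U; s \<in> carrier (sec X U)\<rbrakk> \<Longrightarrow> germ X x U s \<in> carrier (stalk X x)"
  by (auto simp: stalk_def)

lemma stalkE:
  assumes "a \<in> carrier (stalk X x)"
  obtains U s where "is_open X U" "x \<in> U" "s \<in> carrier (sec X U)" "a = germ X x U s"
  using assms by (auto simp: stalk_def)

lemma stalkE2:
  assumes "a \<in> carrier (stalk X x)" "b \<in> carrier (stalk X x)"
  obtains U s t where "is_open X U" "x \<in> U" "s \<in> carrier (sec X U)" "t \<in> carrier (sec X U)"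
    "a = germ X x U s" "b = germ X x U t"
proof -
  obtain U s where U: "is_open X U" "x \<in> U" "s \<in> carrier (sec X U)" "a = germ X x U s"
    using assms stalkE by metis
  obtain V t where V: "is_open X V" "x \<in> V" "t \<in> carrier (sec X V)" "b = germ X x V t"
    using assms stalkE by metis
  show thesis
    using that[of "U \<inter> V" "res X U (U \<inter> V) s" "res X V (U \<inter> V) t"] U V
    by (simp add: openin_Int res_closed germ_res)
qed

text \<open>Passing to a common neighbourhood makes any operation that commutes with restriction well defined
  on germs. Addition and multiplication are both instances.\<close>

lemma stalk_op:
  assumes closed: "\<And>U s t. \<lbrakk>is_open X U; s \<in> carrier (sec X U); t \<in> carrier (sec X U)\<rbrakk>
      \<Longrightarrow> f U s t \<in> carrier (sec X U)"
    and compat: "\<And>U W s t. \<lbrakk>is_open X U; is_open X W; W \<subseteq> U; s \<in> carrier (sec X U);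
      t \<in> carrier (sec X U)\<rbrakk> \<Longrightarrow> res X U W (f U s t) = f W (res X U W s) (res X U W t)"
    and U: "is_open X U" "x \<in> U" "s \<in> carrier (sec X U)" "t \<in> carrier (sec X U)"
  shows "(\<Union>(V, s')\<in>germ X x U s. \<Union>(V', t')\<in>germ X x U t.
      germ X x (V \<inter> V') (f (V \<inter> V') (res X V (V \<inter> V') s') (res X V' (V \<inter> V') t')))
    = germ X x U (f U s t)"
proof (intro UN_pairs_const[OF germ_self] UN_pairs_const[OF germ_self] U)
  fix V s' V' t' assume "(V, s') \<in> germ X x U s" "(V', t') \<in> germ X x U t"
  then obtain W W' where W: "is_open X W" "x \<in> W" "W \<subseteq> U \<inter> V" "res X U W s = res X V W s'"
    and W': "is_open X W'" "x \<in> W'" "W' \<subseteq> U \<inter> V'" "res X U W' t = res X V' W' t'"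
    and V: "is_open X V" "x \<in> V" "s' \<in> carrier (sec X V)"
    and V': "is_open X V'" "x \<in> V'" "t' \<in> carrier (sec X V')"
    unfolding germ_def by blast
  let ?W = "W \<inter> W'" let ?V = "V \<inter> V'"
  have ops: "is_open X ?W" "is_open X ?V" "?W \<subseteq> ?V" "?W \<subseteq> U" "?W \<subseteq> V" "?W \<subseteq> V'"
    using W W' V V' by auto
  have cl: "res X V ?V s' \<in> carrier (sec X ?V)" "res X V' ?V t' \<in> carrier (sec X ?V)"
    using ops V V' by (auto intro!: res_closed)
  have s: "res X V ?W s' = res X U ?W s"
  proof -
    have "res X V ?W s' = res X W ?W (res X V W s')" using ops W V by (subst res_comp) auto
    also have "\<dots> = res X U ?W s" unfolding W(4)[symmetric] using ops W U by (subst res_comp) auto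
    finally show ?thesis .
  qed
  have t: "res X V' ?W t' = res X U ?W t"
  proof -
    have "res X V' ?W t' = res X W' ?W (res X V' W' t')" using ops W' V' by (subst res_comp) auto
    also have "\<dots> = res X U ?W t" unfolding W'(4)[symmetric] using ops W' U by (subst res_comp) auto
    finally show ?thesis .
  qed
  have "res X ?V ?W (f ?V (res X V ?V s') (res X V' ?V t'))
      = f ?W (res X ?V ?W (res X V ?V s')) (res X ?V ?W (res X V' ?V t'))"
    using ops cl by (intro compat) auto
  also have "\<dots> = f ?W (res X U ?W s) (res X U ?W t)"
    using ops V V' by (simp add: res_comp s t)
  also have "\<dots> = res X U ?W (f U s t)"
    using ops U by (intro compat[symmetric]) auto
  finally show "germ X x ?V (f ?V (res X V ?V s') (res X V' ?V t')) = germ X x U (f U s t)"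
    using ops cl U W(2) W'(2) by (intro germ_eqI[where W = ?W]) (auto intro!: closed)
qed

lemma sec_closed:
  assumes "is_open X U" "s \<in> carrier (sec X U)" "t \<in> carrier (sec X U)"
  shows "s \<otimes>\<^bsub>sec X U\<^esub> t \<in> carrier (sec X U)" "s \<oplus>\<^bsub>sec X U\<^esub> t \<in> carrier (sec X U)"
proof -
  interpret cring "sec X U" using assms(1) by (rule cring_sec)
  show "s \<otimes>\<^bsub>sec X U\<^esub> t \<in> carrier (sec X U)" "s \<oplus>\<^bsub>sec X U\<^esub> t \<in> carrier (sec X U)"
    using assms by simp_all
qed

lemma stalk_mult:
  assumes "is_open X U" "x \<in> U" "s \<in> carrier (sec X U)" "t \<in> carrier (sec X U)"
  shows "germ X x U s \<otimes>\<^bsub>stalk X x\<^esub> germ X x U t = germ X x U (s \<otimes>\<^bsub>sec X U\<^esub> t)"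
  using stalk_op[of "\<lambda>U. (\<otimes>\<^bsub>sec X U\<^esub>)", OF _ _ assms] sec_closed ring_hom_mult[OF res_hom]
  by (simp add: stalk_def)

lemma stalk_add:
  assumes "is_open X U" "x \<in> U" "s \<in> carrier (sec X U)" "t \<in> carrier (sec X U)"
  shows "germ X x U s \<oplus>\<^bsub>stalk X x\<^esub> germ X x U t = germ X x U (s \<oplus>\<^bsub>sec X U\<^esub> t)"
  using stalk_op[of "\<lambda>U. (\<oplus>\<^bsub>sec X U\<^esub>)", OF _ _ assms] sec_closed ring_hom_add[OF res_hom]
  by (simp add: stalk_def)

lemma stalk_one:
  assumes "is_open X U" "x \<in> U"
  shows "\<one>\<^bsub>stalk X x\<^esub> = germ X x U \<one>\<^bsub>sec X U\<^esub>"
proof -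
  have U: "U \<subseteq> points X" using assms by (simp add: openin_subset)
  have P: "is_open X (points X)" by simp
  interpret P: cring "sec X (points X)" using P by (rule cring_sec)
  have "germ X x U \<one>\<^bsub>sec X U\<^esub> = germ X x U (res X (points X) U \<one>\<^bsub>sec X (points X)\<^esub>)"
    using ring_hom_one[OF res_hom[OF P assms(1) U]] by simp
  also have "\<dots> = germ X x (points X) \<one>\<^bsub>sec X (points X)\<^esub>"
    using assms U by (intro germ_res) auto
  finally show ?thesis by (simp add: stalk_def)
qed

end

text \<open>Locality on stalks is split off: stalk maps must be known to be well-defined homomorphisms before
  one can speak of it, and the identities between composites do not involve it.\<close>

definition presheaf_mor ::
  "('p, 'r) rspace \<Rightarrow> ('q, 's) rspace \<Rightarrow> ('p, 'r, 'q, 's) mor \<Rightarrow> bool" where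
  "presheaf_mor X Y f \<longleftrightarrow>
     base f \<in> extensional (points X) \<and>
     comap f \<in> extensional {V. is_open Y V} \<and>
     (\<forall>V. is_open Y V \<longrightarrow> comap f V \<in> extensional (carrier (sec Y V))) \<and>
     continuous_map (space_of X) (space_of Y) (base f) \<and>
     (\<forall>V. is_open Y V \<longrightarrow> comap f V \<in> ring_hom (sec Y V) (sec X (preim X f V))) \<and>
     (\<forall>V W. is_open Y V \<and> is_open Y W \<and> W \<subseteq> V \<longrightarrow>
        (\<forall>s\<in>carrier (sec Y V).
           comap f W (res Y V W s) = res X (preim X f V) (preim X f W) (comap f V s)))"

lemma Mor_iff:
  "f \<in> Mor X Y \<longleftrightarrow> presheaf_mor X Y f \<and>
     (\<forall>x\<in>points X. local_hom (stalk Y (base f x)) (stalk X x) (stalk_map X f x))"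
  by (simp add: Mor_def presheaf_mor_def conj_assoc)

lemma presheaf_morD:
  assumes "presheaf_mor X Y f"
  shows "base f \<in> extensional (points X)"
    and "comap f \<in> extensional {V. is_open Y V}"
    and "is_open Y V \<Longrightarrow> comap f V \<in> extensional (carrier (sec Y V))"
    and "continuous_map (space_of X) (space_of Y) (base f)"
    and "is_open Y V \<Longrightarrow> comap f V \<in> ring_hom (sec Y V) (sec X (preim X f V))"
    and "\<lbrakk>is_open Y V; is_open Y W; W \<subseteq> V; s \<in> carrier (sec Y V)\<rbrakk> \<Longrightarrow>
           comap f W (res Y V W s) = res X (preim X f V) (preim X f W) (comap f V s)"
    and "x \<in> points X \<Longrightarrow> base f x \<in> points Y"
    and "is_open Y V \<Longrightarrow> is_open X (preim X f V)"
    and "\<lbrakk>is_open Y V; s \<in> carrier (sec Y V)\<rbrakk> \<Longrightarrow> comap f V s \<in> carrier (sec X (preim X f V))"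
proof -
  show cont: "continuous_map (space_of X) (space_of Y) (base f)"
    using assms by (simp add: presheaf_mor_def)
  show "x \<in> points X \<Longrightarrow> base f x \<in> points Y"
    using cont by (auto simp: continuous_map_def)
  show "is_open Y V \<Longrightarrow> is_open X (preim X f V)"
    unfolding preim_def using cont by (rule openin_continuous_map_preimage)
  show "\<lbrakk>is_open Y V; s \<in> carrier (sec Y V)\<rbrakk> \<Longrightarrow> comap f V s \<in> carrier (sec X (preim X f V))"
    using assms ring_hom_closed unfolding presheaf_mor_def by metis
qed (use assms in \<open>auto simp: presheaf_mor_def\<close>)

lemma preim_mono: "W \<subseteq> V \<Longrightarrow> preim X f W \<subseteq> preim X f V"
  by (auto simp: preim_def)

lemma stalk_map_germ:
  assumes "ring_presheaf X" "ring_presheaf Y" and f: "presheaf_mor X Y f" and x: "x \<in> points X"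
    and V: "is_open Y V" "base f x \<in> V" "s \<in> carrier (sec Y V)"
  shows "stalk_map X f x (germ Y (base f x) V s) = germ X x (preim X f V) (comap f V s)"
proof -
  interpret X: ring_presheaf X by fact
  interpret Y: ring_presheaf Y by fact
  show ?thesis
    unfolding stalk_map_def
  proof (rule UN_pairs_const[OF Y.germ_self[OF V]])
    fix U t assume "(U, t) \<in> germ Y (base f x) V s"
    then obtain W where W: "is_open Y W" "base f x \<in> W" "W \<subseteq> V \<inter> U" "res Y V W s = res Y U W t"
      and U: "is_open Y U" "base f x \<in> U" "t \<in> carrier (sec Y U)"
      unfolding germ_def by blast
    have "res X (preim X f V) (preim X f W) (comap f V s) = comap f W (res Y V W s)"
      using W V by (intro presheaf_morD(6)[OF f, symmetric]) auto
    also have "\<dots> = res X (preim X f U) (preim X f W) (comap f U t)"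
      unfolding W(4) using W U by (intro presheaf_morD(6)[OF f]) auto
    finally have "res X (preim X f U) (preim X f W) (comap f U t) =
      res X (preim X f V) (preim X f W) (comap f V s)" by simp
    moreover have "x \<in> preim X f W" using W x by (simp add: preim_def)
    ultimately show "germ X x (preim X f U) (comap f U t) = germ X x (preim X f V) (comap f V s)"
      using W U V presheaf_morD(8,9)[OF f]
      by (intro X.germ_eqI[where W = "preim X f W"]) (auto intro: preim_mono[THEN subsetD])
  qed
qed

lemma stalk_map_ring_hom:
  assumes "ring_presheaf X" "ring_presheaf Y" and f: "presheaf_mor X Y f" and x: "x \<in> points X"
  shows "stalk_map X f x \<in> ring_hom (stalk Y (base f x)) (stalk X x)"
proof -
  interpret X: ring_presheaf X by fact
  interpret Y: ring_presheaf Y by fact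
  note germ = stalk_map_germ[OF assms]
  have mem: "x \<in> preim X f V \<longleftrightarrow> base f x \<in> V" for V using x by (simp add: preim_def)
  note D = presheaf_morD(8,9)[OF f]
  show ?thesis
  proof (rule ring_hom_memI)
    fix a assume "a \<in> carrier (stalk Y (base f x))"
    then obtain U s where U: "is_open Y U" "base f x \<in> U" "s \<in> carrier (sec Y U)"
      "a = germ Y (base f x) U s" by (metis Y.stalkE)
    then show "stalk_map X f x a \<in> carrier (stalk X x)"
      using D mem by (simp add: germ X.germ_closed)
  next
    fix a b assume "a \<in> carrier (stalk Y (base f x))" "b \<in> carrier (stalk Y (base f x))"
    then obtain U s t where U: "is_open Y U" "base f x \<in> U" "s \<in> carrier (sec Y U)"
      "t \<in> carrier (sec Y U)" "a = germ Y (base f x) U s" "b = germ Y (base f x) U t"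
      by (metis Y.stalkE2)
    note h = presheaf_morD(5)[OF f U(1)]
    show "stalk_map X f x (a \<otimes>\<^bsub>stalk Y (base f x)\<^esub> b) =
        stalk_map X f x a \<otimes>\<^bsub>stalk X x\<^esub> stalk_map X f x b"
      using U D mem by (simp add: germ Y.stalk_mult X.stalk_mult Y.sec_closed ring_hom_mult[OF h])
    show "stalk_map X f x (a \<oplus>\<^bsub>stalk Y (base f x)\<^esub> b) =
        stalk_map X f x a \<oplus>\<^bsub>stalk X x\<^esub> stalk_map X f x b"
      using U D mem by (simp add: germ Y.stalk_add X.stalk_add Y.sec_closed ring_hom_add[OF h])
  next
    have P: "is_open Y (points Y)" by simp
    have fx: "base f x \<in> points Y" using presheaf_morD(7)[OF f x] .
    interpret P: cring "sec Y (points Y)" by (rule Y.cring_sec[OF P])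
    show "stalk_map X f x \<one>\<^bsub>stalk Y (base f x)\<^esub> = \<one>\<^bsub>stalk X x\<^esub>"
      using fx P D(1)[OF P] mem ring_hom_one[OF presheaf_morD(5)[OF f P]]
      by (simp add: Y.stalk_one[OF P fx] germ X.stalk_one[OF D(1)[OF P]])
  qed
qed


lemma ring_hom_cong:
  assumes "ring R" "h \<in> ring_hom R S" "\<And>x. x \<in> carrier R \<Longrightarrow> g x = h x"
  shows "g \<in> ring_hom R S"
proof -
  interpret ring R by fact
  show ?thesis
    using assms(2,3) by (auto simp: ring_hom_def)
qed

lemma preim_comp:
  assumes "presheaf_mor X Y f"
  shows "preim X (comp_mor X Y Z g f) V = preim X f (preim Y g V)"
  using presheaf_morD(7)[OF assms] by (auto simp: preim_def comp_mor_def)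

lemma base_comp: "x \<in> points X \<Longrightarrow> base (comp_mor X Y Z g f) x = base g (base f x)"
  by (simp add: comp_mor_def)

lemma comap_comp:
  "\<lbrakk>is_open Z V; s \<in> carrier (sec Z V)\<rbrakk> \<Longrightarrow>
     comap (comp_mor X Y Z g f) V s = comap f (preim Y g V) (comap g V s)"
  by (simp add: comp_mor_def)

lemma presheaf_mor_comp:
  assumes Z: "ring_presheaf Z" and f: "presheaf_mor X Y f" and g: "presheaf_mor Y Z g"
  shows "presheaf_mor X Z (comp_mor X Y Z g f)"
proof -
  interpret Z: ring_presheaf Z by fact
  note F = presheaf_morD[OF f] and G = presheaf_morD[OF g]
  show ?thesis
    unfolding presheaf_mor_def preim_comp[OF f]
  proof (intro conjI allI impI ballI)
    show "base (comp_mor X Y Z g f) \<in> extensional (points X)" by (simp add: comp_mor_def)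
    show "comap (comp_mor X Y Z g f) \<in> extensional {V. is_open Z V}" by (simp add: comp_mor_def)
    show "continuous_map (space_of X) (space_of Z) (base (comp_mor X Y Z g f))"
      using continuous_map_compose[OF F(4) G(4)]
      by (rule continuous_map_eq) (simp add: base_comp)
  next
    fix V assume V: "is_open Z V"
    show "comap (comp_mor X Y Z g f) V \<in> extensional (carrier (sec Z V))"
      using V by (simp add: comp_mor_def)
    have "comap f (preim Y g V) \<circ> comap g V \<in> ring_hom (sec Z V) (sec X (preim X f (preim Y g V)))"
      using ring_hom_trans[OF G(5)[OF V] F(5)[OF G(8)[OF V]]] .
    then show "comap (comp_mor X Y Z g f) V \<in> ring_hom (sec Z V) (sec X (preim X f (preim Y g V)))"
      by (rule ring_hom_cong[OF cring.axioms(1)[OF Z.cring_sec[OF V]]]) (simp add: comap_comp V)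
  next
    fix V W s assume V: "is_open Z V \<and> is_open Z W \<and> W \<subseteq> V" and s: "s \<in> carrier (sec Z V)"
    then show "comap (comp_mor X Y Z g f) W (res Z V W s) =
      res X (preim X f (preim Y g V)) (preim X f (preim Y g W)) (comap (comp_mor X Y Z g f) V s)"
      by (simp add: comap_comp Z.res_closed F(6) G(6) G(8) G(9) preim_mono)
  qed
qed

lemma stalk_map_comp:
  assumes X: "ring_presheaf X" and Y: "ring_presheaf Y" and Z: "ring_presheaf Z"
    and f: "presheaf_mor X Y f" and g: "presheaf_mor Y Z g"
    and x: "x \<in> points X" and a: "a \<in> carrier (stalk Z (base g (base f x)))"
  shows "stalk_map X (comp_mor X Y Z g f) x a = stalk_map X f x (stalk_map Y g (base f x) a)"
proof -
  note F = presheaf_morD[OF f] and G = presheaf_morD[OF g]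
  obtain U s where U: "is_open Z U" "base g (base f x) \<in> U" "s \<in> carrier (sec Z U)"
      and a: "a = germ Z (base g (base f x)) U s" using ring_presheaf.stalkE[OF Z a] .
  have fx: "base f x \<in> preim Y g U" using U F(7)[OF x] by (simp add: preim_def)
  have "stalk_map X (comp_mor X Y Z g f) x a =
      germ X x (preim X f (preim Y g U)) (comap f (preim Y g U) (comap g U s))"
    using stalk_map_germ[OF X Z presheaf_mor_comp[OF Z f g] x U(1) _ U(3)] U x
    by (simp add: a base_comp preim_comp[OF f] comap_comp)
  also have "\<dots> = stalk_map X f x (stalk_map Y g (base f x) a)"
    unfolding a using U G fx F(7)[OF x]
    by (simp add: stalk_map_germ[OF X Y f x] stalk_map_germ[OF Y Z g])
  finally show ?thesis .
qed

lemma comp_mor_assoc: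
  assumes f: "presheaf_mor X Y f" and g: "presheaf_mor Y Z g" and h: "presheaf_mor Z W h"
  shows "comp_mor X Y W (comp_mor Y Z W h g) f = comp_mor X Z W h (comp_mor X Y Z g f)"
proof -
  have "base (comp_mor X Y W (comp_mor Y Z W h g) f) = base (comp_mor X Z W h (comp_mor X Y Z g f))"
    using presheaf_morD(7)[OF f] by (auto simp: comp_mor_def)
  moreover have "comap (comp_mor X Y W (comp_mor Y Z W h g) f) =
      comap (comp_mor X Z W h (comp_mor X Y Z g f))"
    using presheaf_morD(8,9)[OF h] preim_comp[OF g, of W h]
    by (intro ext) (auto simp: comp_mor_def restrict_def)
  ultimately show ?thesis by simp
qed

lemma preim_id: "V \<subseteq> points X \<Longrightarrow> preim X (id_mor X) V = V"
  by (auto simp: preim_def id_mor_def)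

lemma comp_id_left:
  assumes f: "presheaf_mor X Y f"
  shows "comp_mor X Y Y (id_mor Y) f = f"
proof -
  have "base (comp_mor X Y Y (id_mor Y) f) = base f"
    using presheaf_morD(1,7)[OF f]
    by (intro ext) (auto simp: comp_mor_def id_mor_def extensional_def)
  moreover have "comap (comp_mor X Y Y (id_mor Y) f) V s = comap f V s" for V s
  proof (cases "is_open Y V \<and> s \<in> carrier (sec Y V)")
    case True
    then show ?thesis
      using openin_subset[of "space_of Y" V] by (simp add: comap_comp preim_id) (simp add: id_mor_def)
  next
    case False
    then show ?thesis
      using presheaf_morD(2,3)[OF f] by (auto simp: comp_mor_def extensional_def)
  qed
  then have "comap (comp_mor X Y Y (id_mor Y) f) = comap f" by (intro ext)
  ultimately show ?thesis by simp
qed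

lemma comp_id_right:
  assumes f: "presheaf_mor X Y f"
  shows "comp_mor X X Y f (id_mor X) = f"
proof -
  have "base (comp_mor X X Y f (id_mor X)) = base f"
    using presheaf_morD(1)[OF f]
    by (intro ext) (auto simp: comp_mor_def id_mor_def extensional_def)
  moreover have "comap (comp_mor X X Y f (id_mor X)) V s = comap f V s" for V s
    using presheaf_morD(2,3,8,9)[OF f]
    by (cases "is_open Y V")
      (auto simp: comp_mor_def id_mor_def extensional_def restrict_def)
  then have "comap (comp_mor X X Y f (id_mor X)) = comap f" by (intro ext)
  ultimately show ?thesis by simp
qed

lemma presheaf_mor_id:
  assumes "ring_presheaf X"
  shows "presheaf_mor X X (id_mor X)"
proof -
  interpret ring_presheaf X by fact
  have c: "comap (id_mor X) V s = s" if "is_open X V" "s \<in> carrier (sec X V)" for V s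
    using that by (simp add: id_mor_def)
  have p: "preim X (id_mor X) V = V" if "is_open X V" for V
    using openin_subset[OF that] by (rule preim_id)
  show ?thesis
    unfolding presheaf_mor_def
  proof (intro conjI allI impI ballI)
    show "continuous_map (space_of X) (space_of X) (base (id_mor X))"
      using continuous_map_id by (rule continuous_map_eq) (simp add: id_mor_def)
  next
    fix V assume V: "is_open X V"
    show "comap (id_mor X) V \<in> ring_hom (sec X V) (sec X (preim X (id_mor X) V))"
      unfolding p[OF V]
    proof (rule ring_hom_cong)
      show "ring (sec X V)" using cring_sec[OF V] by (rule cring.axioms)
      show "(\<lambda>s. s) \<in> ring_hom (sec X V) (sec X V)" by (simp add: ring_hom_def)
    qed (rule c[OF V])
  next
    fix V W s assume VW: "is_open X V \<and> is_open X W \<and> W \<subseteq> V" and s: "s \<in> carrier (sec X V)"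
    then show "comap (id_mor X) W (res X V W s) =
      res X (preim X (id_mor X) V) (preim X (id_mor X) W) (comap (id_mor X) V s)"
      by (simp add: c p res_closed)
  qed (simp_all add: id_mor_def)
qed

lemma stalk_map_id:
  assumes X: "ring_presheaf X" and x: "x \<in> points X" and a: "a \<in> carrier (stalk X x)"
  shows "stalk_map X (id_mor X) x a = a"
proof -
  obtain U s where U: "is_open X U" "x \<in> U" "s \<in> carrier (sec X U)" and a: "a = germ X x U s"
    using ring_presheaf.stalkE[OF X a] .
  have "base (id_mor X) x = x" using x by (simp add: id_mor_def)
  then show ?thesis
    using stalk_map_germ[OF X X presheaf_mor_id[OF X] x U(1) _ U(3)] U openin_subset[OF U(1)]
    by (simp add: a preim_id) (simp add: id_mor_def)
qed

text \<open>Maximal ideals are compared through a maximal ideal of the intermediate stalk, which exists because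
  \<open>Y\<close> is locally ringed.\<close>

lemma Mor_comp:
  assumes "locally_ringed_space X" "locally_ringed_space Y" "ring_presheaf Z"
    and f: "f \<in> Mor X Y" and g: "g \<in> Mor Y Z"
  shows "comp_mor X Y Z g f \<in> Mor X Z"
proof -
  interpret X: locally_ringed_space X by fact
  interpret Y: locally_ringed_space Y by fact
  interpret Z: ring_presheaf Z by fact
  note pX = X.ring_presheaf_axioms and pY = Y.ring_presheaf_axioms and pZ = assms(3)
  have f': "presheaf_mor X Y f" and g': "presheaf_mor Y Z g" using f g by (auto simp: Mor_iff)
  note pc = presheaf_mor_comp[OF pZ f' g']
  have "local_hom (stalk Z (base (comp_mor X Y Z g f) x)) (stalk X x)
      (stalk_map X (comp_mor X Y Z g f) x)" if x: "x \<in> points X" for x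
    unfolding local_hom_def
  proof (intro conjI allI impI)
    show "stalk_map X (comp_mor X Y Z g f) x
        \<in> ring_hom (stalk Z (base (comp_mor X Y Z g f) x)) (stalk X x)"
      using stalk_map_ring_hom[OF pX pZ pc x] .
    fix M N assume MN: "maximalideal M (stalk Z (base (comp_mor X Y Z g f) x)) \<and>
      maximalideal N (stalk X x)"
    have y: "base f x \<in> points Y" using presheaf_morD(7)[OF f' x] .
    obtain K where K: "maximalideal K (stalk Y (base f x))"
      using Y.local_stalks[OF y] by (auto simp: local_ring_def)
    have M: "maximalideal M (stalk Z (base g (base f x)))" using MN x by (simp add: base_comp)
    then have Ms: "M \<subseteq> carrier (stalk Z (base g (base f x)))"
      by (meson additive_subgroup.a_subset ideal_def maximalideal_def)
    have "stalk_map Y g (base f x) ` M \<subseteq> K"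
      using g y M K by (auto simp: Mor_iff local_hom_def)
    moreover have "stalk_map X f x ` K \<subseteq> N"
      using f x MN K by (auto simp: Mor_iff local_hom_def)
    moreover have "stalk_map X (comp_mor X Y Z g f) x a = stalk_map X f x (stalk_map Y g (base f x) a)"
      if "a \<in> M" for a
      using stalk_map_comp[OF pX pY pZ f' g' x] Ms that by blast
    ultimately show "stalk_map X (comp_mor X Y Z g f) x ` M \<subseteq> N"
      by (simp add: image_subset_iff)
  qed
  then show ?thesis using pc by (simp add: Mor_iff)
qed

lemma Mor_id:
  assumes "locally_ringed_space X"
  shows "id_mor X \<in> Mor X X"
proof -
  interpret X: locally_ringed_space X by fact
  note pX = X.ring_presheaf_axioms
  have "local_hom (stalk X (base (id_mor X) x)) (stalk X x) (stalk_map X (id_mor X) x)"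
    if x: "x \<in> points X" for x
    unfolding local_hom_def
  proof (intro conjI allI impI)
    show "stalk_map X (id_mor X) x \<in> ring_hom (stalk X (base (id_mor X) x)) (stalk X x)"
      using stalk_map_ring_hom[OF pX pX presheaf_mor_id[OF pX] x] .
    fix M N assume "maximalideal M (stalk X (base (id_mor X) x)) \<and> maximalideal N (stalk X x)"
    moreover have "base (id_mor X) x = x" using x by (simp add: id_mor_def)
    ultimately have M: "maximalideal M (stalk X x)" and "N = M"
      using X.local_stalks[OF x] by (auto simp: local_ring_def)
    moreover have "M \<subseteq> carrier (stalk X x)"
      using M by (meson additive_subgroup.a_subset ideal_def maximalideal_def)
    ultimately show "stalk_map X (id_mor X) x ` M \<subseteq> N"
      using stalk_map_id[OF pX x] by (simp add: image_subset_iff subset_iff)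
  qed
  then show ?thesis using presheaf_mor_id[OF pX] by (simp add: Mor_iff)
qed

section \<open>Spectra and ring homomorphisms\<close>

lemma mult_subset_prime:
  assumes "primeideal P R"
  shows "mult_subset R (carrier R - P)"
proof -
  interpret primeideal P R by fact
  have "\<one>\<^bsub>R\<^esub> \<notin> P" using I_notcarr one_imp_carrier by blast
  then show ?thesis
    by unfold_locales (use I_prime in auto)
qed

lemma points_Spec:
  assumes "ring R"
  shows "points (Spec R) = {P. primeideal P R}"
proof -
  interpret ring R by fact
  have "zariski_open R (carrier R) = {P. primeideal P R}"
  proof -
    have "\<not> carrier R \<subseteq> P" if "primeideal P R" for P
      using primeideal.I_notcarr[OF that] ideal.Icarr[OF primeideal.axioms(1)[OF that]] by blast
    then show ?thesis by (auto simp: zariski_open_def)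
  qed
  then have "openin (zariski_topology R) {P. primeideal P R}"
    by (metis openin_zariski subset_refl)
  then have "{P. primeideal P R} \<subseteq> points (Spec R)"
    by (simp add: Spec_def openin_subset)
  moreover have "points (Spec R) \<subseteq> {P. primeideal P R}"
  proof -
    obtain E where "topspace (zariski_topology R) = zariski_open R E"
      using openin_topspace[of "zariski_topology R"] unfolding openin_zariski by blast
    then show ?thesis by (simp add: Spec_def) (auto simp: zariski_open_def)
  qed
  ultimately show ?thesis by (rule equalityI[rotated])
qed

lemma is_open_Spec: "is_open (Spec R) U \<longleftrightarrow> openin (zariski_topology R) U"
  by (simp add: Spec_def)

lemma prime_if_open: "\<lbrakk>is_open (Spec R) U; P \<in> U\<rbrakk> \<Longrightarrow> primeideal P R"
  by (auto simp: is_open_Spec openin_zariski zariski_open_def)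

lemma Spec_simps:
  "carrier (sec (Spec R) U) = spec_sections R U"
  "\<sigma> \<otimes>\<^bsub>sec (Spec R) U\<^esub> \<tau> = (\<lambda>P\<in>U. \<sigma> P \<otimes>\<^bsub>localization R (carrier R - P)\<^esub> \<tau> P)"
  "\<sigma> \<oplus>\<^bsub>sec (Spec R) U\<^esub> \<tau> = (\<lambda>P\<in>U. \<sigma> P \<oplus>\<^bsub>localization R (carrier R - P)\<^esub> \<tau> P)"
  "\<one>\<^bsub>sec (Spec R) U\<^esub> = (\<lambda>P\<in>U. \<one>\<^bsub>localization R (carrier R - P)\<^esub>)"
  "\<zero>\<^bsub>sec (Spec R) U\<^esub> = (\<lambda>P\<in>U. \<zero>\<^bsub>localization R (carrier R - P)\<^esub>)"
  "res (Spec R) U V \<sigma> = restrict \<sigma> V"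
  by (simp_all add: Spec_def)

lemma spec_sections_ext:
  assumes "\<sigma> \<in> spec_sections R U" "\<tau> \<in> spec_sections R U" "\<And>P. P \<in> U \<Longrightarrow> \<sigma> P = \<tau> P"
  shows "\<sigma> = \<tau>"
  using assms by (intro PiE_ext[of \<sigma> U _ \<tau>]) (auto simp: spec_sections_def)

text \<open>Two sections near a point can be represented by fractions on one and the same \<open>V\<close>; this is why their
  sums and products are sections again.\<close>

definition fraction_on :: "'a ring \<Rightarrow> 'a set set \<Rightarrow> 'a \<Rightarrow> 'a \<Rightarrow> ('a set \<Rightarrow> ('a \<times> 'a) set) \<Rightarrow> bool" where
  "fraction_on R V a f \<sigma> \<longleftrightarrow> is_open (Spec R) V \<and> a \<in> carrier R \<and> f \<in> carrier R \<and>
     (\<forall>Q\<in>V. f \<notin> Q \<and> \<sigma> Q = frac R (carrier R - Q) a f)"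

lemma fraction_onD:
  assumes "fraction_on R V a f \<sigma>"
  shows "is_open (Spec R) V" "a \<in> carrier R" "f \<in> carrier R" "Q \<in> V \<Longrightarrow> f \<notin> Q"
    "Q \<in> V \<Longrightarrow> \<sigma> Q = frac R (carrier R - Q) a f"
  using assms by (simp_all add: fraction_on_def)

lemma spec_sections_iff:
  "\<sigma> \<in> spec_sections R U \<longleftrightarrow> \<sigma> \<in> extensional U \<and>
     (\<forall>P\<in>U. \<exists>V a f. P \<in> V \<and> V \<subseteq> U \<and> fraction_on R V a f \<sigma>)" (is "?l \<longleftrightarrow> ?r")
proof
  assume l: ?l
  have "\<exists>V a f. P \<in> V \<and> V \<subseteq> U \<and> fraction_on R V a f \<sigma>" if P: "P \<in> U" for P
  proof -
    have "\<exists>V. openin (zariski_topology R) V \<and> P \<in> V \<and> V \<subseteq> U \<and>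
          (\<exists>a\<in>carrier R. \<exists>f\<in>carrier R. \<forall>Q\<in>V. f \<notin> Q \<and> \<sigma> Q = frac R (carrier R - Q) a f)"
      using l P by (simp add: spec_sections_def)
    then obtain V a f where "openin (zariski_topology R) V" "P \<in> V" "V \<subseteq> U"
      "a \<in> carrier R" "f \<in> carrier R" "\<forall>Q\<in>V. f \<notin> Q \<and> \<sigma> Q = frac R (carrier R - Q) a f"
      by (elim exE bexE conjE)
    then have "P \<in> V \<and> V \<subseteq> U \<and> fraction_on R V a f \<sigma>"
      by (simp add: fraction_on_def is_open_Spec)
    then show ?thesis by (intro exI)
  qed
  moreover have "\<sigma> \<in> extensional U" using l by (simp add: spec_sections_def PiE_def)
  ultimately show ?r by (simp only: ball_simps) simp
next
  assume r: ?r
  have "\<sigma> P \<in> carrier (localization R (carrier R - P)) \<and>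
      (\<exists>V. openin (zariski_topology R) V \<and> P \<in> V \<and> V \<subseteq> U \<and>
        (\<exists>a\<in>carrier R. \<exists>f\<in>carrier R. \<forall>Q\<in>V. f \<notin> Q \<and> \<sigma> Q = frac R (carrier R - Q) a f))"
    if P: "P \<in> U" for P
  proof
    have "\<exists>V a f. P \<in> V \<and> V \<subseteq> U \<and> fraction_on R V a f \<sigma>" using r P by simp
    then obtain V a f where V: "P \<in> V" "V \<subseteq> U" "fraction_on R V a f \<sigma>" by (elim exE conjE)
    then have "f \<notin> P" "\<sigma> P = frac R (carrier R - P) a f" "a \<in> carrier R" "f \<in> carrier R"
      by (simp_all add: fraction_on_def)
    then show "\<sigma> P \<in> carrier (localization R (carrier R - P))"
      by (auto simp: localization_def)
    show "\<exists>V. openin (zariski_topology R) V \<and> P \<in> V \<and> V \<subseteq> U \<and>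
        (\<exists>a\<in>carrier R. \<exists>f\<in>carrier R. \<forall>Q\<in>V. f \<notin> Q \<and> \<sigma> Q = frac R (carrier R - Q) a f)"
      using V unfolding fraction_on_def is_open_Spec
      by (intro exI[of _ V] conjI bexI[of _ a] bexI[of _ f]) simp_all
  qed
  then show ?l
    using r by (simp add: spec_sections_def PiE_def)
qed

lemma spec_sections_localE:
  assumes "\<sigma> \<in> spec_sections R U" "P \<in> U"
  obtains V a f where "P \<in> V" "V \<subseteq> U" "fraction_on R V a f \<sigma>"
proof -
  have "\<exists>V a f. P \<in> V \<and> V \<subseteq> U \<and> fraction_on R V a f \<sigma>"
    using assms unfolding spec_sections_iff by simp
  then show thesis using that by (elim exE conjE)
qed

lemma spec_sectionsI:
  assumes "\<And>P. P \<in> U \<Longrightarrow> \<exists>V a f. P \<in> V \<and> V \<subseteq> U \<and> fraction_on R V a f \<sigma>"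
  shows "restrict \<sigma> U \<in> spec_sections R U"
  unfolding spec_sections_iff
proof (intro conjI ballI)
  fix P assume "P \<in> U"
  from assms[OF this] obtain V a f where V: "P \<in> V" "V \<subseteq> U" "fraction_on R V a f \<sigma>"
    by (elim exE conjE)
  moreover have "fraction_on R V a f (restrict \<sigma> U)"
    using V(2,3) by (simp add: fraction_on_def subset_iff)
  ultimately show "\<exists>V a f. P \<in> V \<and> V \<subseteq> U \<and> fraction_on R V a f (restrict \<sigma> U)"
    by (intro exI conjI)
qed simp

lemma spec_sections_const:
  assumes "is_open (Spec R) U" "a \<in> carrier R" "f \<in> carrier R" "\<And>Q. Q \<in> U \<Longrightarrow> f \<notin> Q"
  shows "(\<lambda>P\<in>U. frac R (carrier R - P) a f) \<in> spec_sections R U"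
proof (rule spec_sectionsI)
  fix P assume P: "P \<in> U"
  have "fraction_on R U a f (\<lambda>P. frac R (carrier R - P) a f)"
    using assms by (simp add: fraction_on_def)
  then show "\<exists>V b g. P \<in> V \<and> V \<subseteq> U \<and> fraction_on R V b g (\<lambda>P. frac R (carrier R - P) a f)"
    using P by blast
qed

lemma fraction_on_Int:
  assumes "fraction_on R V a f \<sigma>" "is_open (Spec R) W"
  shows "fraction_on R (V \<inter> W) a f \<sigma>"
  using assms by (simp add: fraction_on_def openin_Int)

lemma fraction_on_ops:
  assumes \<sigma>: "fraction_on R V a f \<sigma>" and \<tau>: "fraction_on R V b g \<tau>" and "P \<in> V"
  shows "fraction_on R V (a \<otimes>\<^bsub>R\<^esub> b) (f \<otimes>\<^bsub>R\<^esub> g) (\<lambda>P. \<sigma> P \<otimes>\<^bsub>localization R (carrier R - P)\<^esub> \<tau> P)"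
    and "fraction_on R V (g \<otimes>\<^bsub>R\<^esub> a \<oplus>\<^bsub>R\<^esub> f \<otimes>\<^bsub>R\<^esub> b) (f \<otimes>\<^bsub>R\<^esub> g)
           (\<lambda>P. \<sigma> P \<oplus>\<^bsub>localization R (carrier R - P)\<^esub> \<tau> P)"
proof -
  have V: "is_open (Spec R) V" and c: "a \<in> carrier R" "f \<in> carrier R" "b \<in> carrier R" "g \<in> carrier R"
    using assms by (simp_all add: fraction_on_def)
  interpret P: primeideal P R using prime_if_open[OF V \<open>P \<in> V\<close>] .
  have *: "f \<otimes>\<^bsub>R\<^esub> g \<notin> Q \<and>
      \<sigma> Q \<otimes>\<^bsub>localization R (carrier R - Q)\<^esub> \<tau> Q = frac R (carrier R - Q) (a \<otimes>\<^bsub>R\<^esub> b) (f \<otimes>\<^bsub>R\<^esub> g) \<and>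
      \<sigma> Q \<oplus>\<^bsub>localization R (carrier R - Q)\<^esub> \<tau> Q =
        frac R (carrier R - Q) (g \<otimes>\<^bsub>R\<^esub> a \<oplus>\<^bsub>R\<^esub> f \<otimes>\<^bsub>R\<^esub> b) (f \<otimes>\<^bsub>R\<^esub> g)"
    if Q: "Q \<in> V" for Q
  proof -
    interpret M: mult_subset R "carrier R - Q" using mult_subset_prime[OF prime_if_open[OF V Q]] .
    have fg: "f \<notin> Q" "g \<notin> Q" and "\<sigma> Q = frac R (carrier R - Q) a f" "\<tau> Q = frac R (carrier R - Q) b g"
      using Q \<sigma> \<tau> by (simp_all add: fraction_on_def)
    moreover have "f \<otimes>\<^bsub>R\<^esub> g \<notin> Q" using M.mult_S[of f g] c fg by simp
    ultimately show ?thesis using c by (simp add: M.frac_mult M.frac_add)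
  qed
  show "fraction_on R V (a \<otimes>\<^bsub>R\<^esub> b) (f \<otimes>\<^bsub>R\<^esub> g) (\<lambda>P. \<sigma> P \<otimes>\<^bsub>localization R (carrier R - P)\<^esub> \<tau> P)"
    "fraction_on R V (g \<otimes>\<^bsub>R\<^esub> a \<oplus>\<^bsub>R\<^esub> f \<otimes>\<^bsub>R\<^esub> b) (f \<otimes>\<^bsub>R\<^esub> g)
       (\<lambda>P. \<sigma> P \<oplus>\<^bsub>localization R (carrier R - P)\<^esub> \<tau> P)"
    using V c * unfolding fraction_on_def by simp_all
qed

lemma spec_sections_ops:
  assumes "\<sigma> \<in> spec_sections R U" "\<tau> \<in> spec_sections R U"
  shows "(\<lambda>P\<in>U. \<sigma> P \<otimes>\<^bsub>localization R (carrier R - P)\<^esub> \<tau> P) \<in> spec_sections R U" (is ?mult)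
    and "(\<lambda>P\<in>U. \<sigma> P \<oplus>\<^bsub>localization R (carrier R - P)\<^esub> \<tau> P) \<in> spec_sections R U" (is ?add)
proof -
  have "\<exists>V a f b g. P \<in> V \<and> V \<subseteq> U \<and> fraction_on R V a f \<sigma> \<and> fraction_on R V b g \<tau>"
    if P: "P \<in> U" for P
  proof -
    obtain V a f where V: "P \<in> V" "V \<subseteq> U" "fraction_on R V a f \<sigma>"
      using spec_sections_localE[OF assms(1) P] .
    obtain W b g where W: "P \<in> W" "W \<subseteq> U" "fraction_on R W b g \<tau>"
      using spec_sections_localE[OF assms(2) P] .
    have "P \<in> V \<inter> W" "V \<inter> W \<subseteq> U" using V W by auto
    moreover have "fraction_on R (V \<inter> W) a f \<sigma>"
      by (rule fraction_on_Int[OF V(3)]) (use W(3) in \<open>simp add: fraction_on_def\<close>)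
    moreover have "fraction_on R (V \<inter> W) b g \<tau>"
      unfolding Int_commute[of V]
      by (rule fraction_on_Int[OF W(3)]) (use V(3) in \<open>simp add: fraction_on_def\<close>)
    ultimately show ?thesis by (intro exI conjI)
  qed
  note loc = this
  show ?mult
  proof (rule spec_sectionsI)
    fix P assume "P \<in> U"
    from loc[OF this] obtain V a f b g where
      V: "P \<in> V" "V \<subseteq> U" "fraction_on R V a f \<sigma>" "fraction_on R V b g \<tau>" by (elim exE conjE)
    show "\<exists>V a f. P \<in> V \<and> V \<subseteq> U \<and>
        fraction_on R V a f (\<lambda>P. \<sigma> P \<otimes>\<^bsub>localization R (carrier R - P)\<^esub> \<tau> P)"
      by (intro exI conjI) (rule V fraction_on_ops(1)[OF V(3,4,1)])+
  qed
  show ?add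
  proof (rule spec_sectionsI)
    fix P assume "P \<in> U"
    from loc[OF this] obtain V a f b g where
      V: "P \<in> V" "V \<subseteq> U" "fraction_on R V a f \<sigma>" "fraction_on R V b g \<tau>" by (elim exE conjE)
    show "\<exists>V a f. P \<in> V \<and> V \<subseteq> U \<and>
        fraction_on R V a f (\<lambda>P. \<sigma> P \<oplus>\<^bsub>localization R (carrier R - P)\<^esub> \<tau> P)"
      by (intro exI conjI) (rule V fraction_on_ops(2)[OF V(3,4,1)])+
  qed
qed

lemma spec_sections_restrict:
  assumes "\<sigma> \<in> spec_sections R U" "is_open (Spec R) V" "V \<subseteq> U"
  shows "restrict \<sigma> V \<in> spec_sections R V"
proof (rule spec_sectionsI)
  fix P assume P: "P \<in> V"
  then have PU: "P \<in> U" using assms(3) by blast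
  obtain W a f where W: "P \<in> W" "W \<subseteq> U" "fraction_on R W a f \<sigma>"
    using spec_sections_localE[OF assms(1) PU] .
  have "P \<in> W \<inter> V" "W \<inter> V \<subseteq> V" using W P by auto
  then show "\<exists>W a f. P \<in> W \<and> W \<subseteq> V \<and> fraction_on R W a f \<sigma>"
    using fraction_on_Int[OF W(3) assms(2)] by (intro exI conjI)
qed

lemma spec_sections_apply:
  "\<lbrakk>\<sigma> \<in> spec_sections R U; P \<in> U\<rbrakk> \<Longrightarrow> \<sigma> P \<in> carrier (localization R (carrier R - P))"
  by (auto simp: spec_sections_def)

lemma cring_sec_Spec:
  assumes "cring R" and U: "is_open (Spec R) U"
  shows "cring (sec (Spec R) U)"
proof -
  interpret R: cring R by fact
  let ?L = "\<lambda>P. localization R (carrier R - P)"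
  have M: "mult_subset R (carrier R - P)" if "P \<in> U" for P
    using mult_subset_prime prime_if_open[OF U that] .
  have L: "cring (?L P)" if "P \<in> U" for P using mult_subset.cring_localization[OF M[OF that]] .
  note R = cring.axioms(1)[OF L]
  note ag = ring.is_abelian_group[OF R]
  have one_notin: "\<one>\<^bsub>R\<^esub> \<notin> P" if "P \<in> U" for P
    using mult_subset.one_S[OF M[OF that]] by simp
  have const: "(\<lambda>P\<in>U. frac R (carrier R - P) a \<one>\<^bsub>R\<^esub>) \<in> spec_sections R U" if "a \<in> carrier R" for a
    using that one_notin by (intro spec_sections_const U) auto
  have "(\<lambda>P\<in>U. \<zero>\<^bsub>?L P\<^esub>) = (\<lambda>P\<in>U. frac R (carrier R - P) \<zero>\<^bsub>R\<^esub> \<one>\<^bsub>R\<^esub>)"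
    "(\<lambda>P\<in>U. \<one>\<^bsub>?L P\<^esub>) = (\<lambda>P\<in>U. frac R (carrier R - P) \<one>\<^bsub>R\<^esub> \<one>\<^bsub>R\<^esub>)"
    by (simp_all add: localization_def)
  then have zero: "(\<lambda>P\<in>U. \<zero>\<^bsub>?L P\<^esub>) \<in> spec_sections R U" and one: "(\<lambda>P\<in>U. \<one>\<^bsub>?L P\<^esub>) \<in> spec_sections R U"
    using const by simp_all
  note app = spec_sections_apply
  show ?thesis
  proof (rule cringI)
    show "abelian_group (sec (Spec R) U)"
    proof (rule abelian_groupI, unfold Spec_simps)
      fix x y z assume x: "x \<in> spec_sections R U" and y: "y \<in> spec_sections R U"
      show xy: "(\<lambda>P\<in>U. x P \<oplus>\<^bsub>?L P\<^esub> y P) \<in> spec_sections R U"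
        using spec_sections_ops(2)[OF x y] .
      show "(\<lambda>P\<in>U. x P \<oplus>\<^bsub>?L P\<^esub> y P) = (\<lambda>P\<in>U. y P \<oplus>\<^bsub>?L P\<^esub> x P)"
        using x y by (intro restrict_ext) (simp add: app abelian_monoid.a_comm[OF abelian_group.axioms(1)[OF ag]])
      assume z: "z \<in> spec_sections R U"
      show "(\<lambda>P\<in>U. (\<lambda>P\<in>U. x P \<oplus>\<^bsub>?L P\<^esub> y P) P \<oplus>\<^bsub>?L P\<^esub> z P) =
          (\<lambda>P\<in>U. x P \<oplus>\<^bsub>?L P\<^esub> (\<lambda>P\<in>U. y P \<oplus>\<^bsub>?L P\<^esub> z P) P)"
        using x y z by (intro restrict_ext)
          (simp add: app abelian_monoid.a_assoc[OF abelian_group.axioms(1)[OF ag]])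
    next
      show "(\<lambda>P\<in>U. \<zero>\<^bsub>?L P\<^esub>) \<in> spec_sections R U" by (rule zero)
    next
      fix x assume x: "x \<in> spec_sections R U"
      show "(\<lambda>P\<in>U. (\<lambda>P\<in>U. \<zero>\<^bsub>?L P\<^esub>) P \<oplus>\<^bsub>?L P\<^esub> x P) = x"
        using spec_sections_ops(2)[OF zero x] x
        by (rule spec_sections_ext)
          (simp add: app[OF x] abelian_monoid.l_zero[OF abelian_group.axioms(1)[OF ag]])
      let ?m = "\<lambda>P\<in>U. frac R (carrier R - P) (\<ominus>\<^bsub>R\<^esub> \<one>\<^bsub>R\<^esub>) \<one>\<^bsub>R\<^esub>"
      let ?y = "\<lambda>P\<in>U. ?m P \<otimes>\<^bsub>?L P\<^esub> x P"
      have "?m \<in> spec_sections R U" by (intro const) simp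
      then have y: "?y \<in> spec_sections R U" using spec_sections_ops(1) x by blast
      have "?y P \<oplus>\<^bsub>?L P\<^esub> x P = \<zero>\<^bsub>?L P\<^esub>" if P: "P \<in> U" for P
      proof -
        interpret P: mult_subset R "carrier R - P" using M[OF P] .
        obtain a s where "a \<in> carrier R" "s \<in> carrier R - P" "x P = frac R (carrier R - P) a s"
          using P.localizationE[OF app[OF x P]] .
        then show ?thesis using P P.frac_l_neg by simp
      qed
      then have "(\<lambda>P\<in>U. ?y P \<oplus>\<^bsub>?L P\<^esub> x P) = (\<lambda>P\<in>U. \<zero>\<^bsub>?L P\<^esub>)"
        by (intro restrict_ext)
      then show "\<exists>y\<in>spec_sections R U. (\<lambda>P\<in>U. y P \<oplus>\<^bsub>?L P\<^esub> x P) = (\<lambda>P\<in>U. \<zero>\<^bsub>?L P\<^esub>)"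
        using y by (rule bexI)
    qed
    show "comm_monoid (sec (Spec R) U)"
    proof (rule comm_monoidI, unfold Spec_simps)
      show "(\<lambda>P\<in>U. \<one>\<^bsub>?L P\<^esub>) \<in> spec_sections R U" by (rule one)
    next
      fix x y assume x: "x \<in> spec_sections R U" and y: "y \<in> spec_sections R U"
      show xy: "(\<lambda>P\<in>U. x P \<otimes>\<^bsub>?L P\<^esub> y P) \<in> spec_sections R U"
        using spec_sections_ops(1)[OF x y] .
      show "(\<lambda>P\<in>U. x P \<otimes>\<^bsub>?L P\<^esub> y P) = (\<lambda>P\<in>U. y P \<otimes>\<^bsub>?L P\<^esub> x P)"
        using x y by (intro restrict_ext) (simp add: app comm_monoid.m_comm[OF cring.axioms(2)[OF L]])
      fix z assume z: "z \<in> spec_sections R U"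
      show "(\<lambda>P\<in>U. (\<lambda>P\<in>U. x P \<otimes>\<^bsub>?L P\<^esub> y P) P \<otimes>\<^bsub>?L P\<^esub> z P) =
          (\<lambda>P\<in>U. x P \<otimes>\<^bsub>?L P\<^esub> (\<lambda>P\<in>U. y P \<otimes>\<^bsub>?L P\<^esub> z P) P)"
        using x y z by (intro restrict_ext)
          (simp add: app monoid.m_assoc[OF ring.is_monoid[OF R]])
    next
      fix x assume x: "x \<in> spec_sections R U"
      show "(\<lambda>P\<in>U. (\<lambda>P\<in>U. \<one>\<^bsub>?L P\<^esub>) P \<otimes>\<^bsub>?L P\<^esub> x P) = x"
        using spec_sections_ops(1)[OF one x] x
        by (rule spec_sections_ext)
          (simp add: app[OF x] monoid.l_one[OF ring.is_monoid[OF R]])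
    qed
    fix x y z assume xyz: "x \<in> carrier (sec (Spec R) U)" "y \<in> carrier (sec (Spec R) U)"
      "z \<in> carrier (sec (Spec R) U)"
    have "(x P \<oplus>\<^bsub>?L P\<^esub> y P) \<otimes>\<^bsub>?L P\<^esub> z P = x P \<otimes>\<^bsub>?L P\<^esub> z P \<oplus>\<^bsub>?L P\<^esub> y P \<otimes>\<^bsub>?L P\<^esub> z P"
      if P: "P \<in> U" for P
    proof -
      interpret P: cring "?L P" using L[OF P] .
      show ?thesis using xyz P by (simp add: Spec_simps app P.l_distr)
    qed
    then show "(x \<oplus>\<^bsub>sec (Spec R) U\<^esub> y) \<otimes>\<^bsub>sec (Spec R) U\<^esub> z =
      (x \<otimes>\<^bsub>sec (Spec R) U\<^esub> z) \<oplus>\<^bsub>sec (Spec R) U\<^esub> (y \<otimes>\<^bsub>sec (Spec R) U\<^esub> z)"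
      unfolding Spec_simps by (intro restrict_ext) simp
  qed
qed

lemma ring_presheaf_Spec:
  assumes "cring R"
  shows "ring_presheaf (Spec R)"
proof (rule ring_presheaf.intro)
  fix U V :: "'a set set" assume U: "is_open (Spec R) U" and V: "is_open (Spec R) V" "V \<subseteq> U"
  show "res (Spec R) U V \<in> ring_hom (sec (Spec R) U) (sec (Spec R) V)"
  proof (rule ring_hom_memI; unfold Spec_simps)
    show "restrict \<sigma> V \<in> spec_sections R V" if "\<sigma> \<in> spec_sections R U" for \<sigma>
      using spec_sections_restrict[OF that V] .
  qed (use V in \<open>auto simp: restrict_def fun_eq_iff\<close>)
next
  fix U :: "'a set set" and s assume "is_open (Spec R) U" "s \<in> carrier (sec (Spec R) U)"
  then show "res (Spec R) U U s = s"
    by (auto simp: Spec_simps spec_sections_def PiE_def extensional_restrict)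
next
  fix U V W :: "'a set set" and s :: "'a set \<Rightarrow> ('a \<times> 'a) set" assume "W \<subseteq> V" "V \<subseteq> U" 
  then show "res (Spec R) V W (res (Spec R) U V s) = res (Spec R) U W s"
    by (simp add: Spec_simps Int_absorb1)
qed (rule cring_sec_Spec[OF assms])


lemma primeideal_vimage:
  assumes "cring R" "cring S" and h: "h \<in> ring_hom R S" and Q: "primeideal Q S"
  shows "primeideal {a \<in> carrier R. h a \<in> Q} R"
proof -
  interpret Q: primeideal Q S by fact
  interpret R: cring R by fact
  interpret h: ring_hom_ring R S h
    by (rule ring_hom_ringI2[OF R.ring_axioms Q.ring_axioms h])
  show ?thesis
  proof (rule primeidealI)
    show "ideal {a \<in> carrier R. h a \<in> Q} R" by (rule h.ideal_vimage) (rule Q.is_ideal)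
    have "\<one>\<^bsub>S\<^esub> \<notin> Q" using Q.I_notcarr Q.one_imp_carrier by blast
    then have "\<one>\<^bsub>R\<^esub> \<notin> {a \<in> carrier R. h a \<in> Q}" by simp
    then show "carrier R \<noteq> {a \<in> carrier R. h a \<in> Q}" by blast
    fix a b assume "a \<in> carrier R" "b \<in> carrier R" "a \<otimes>\<^bsub>R\<^esub> b \<in> {a \<in> carrier R. h a \<in> Q}"
    then show "a \<in> {a \<in> carrier R. h a \<in> Q} \<or> b \<in> {a \<in> carrier R. h a \<in> Q}"
      using Q.I_prime[of "h a" "h b"] by simp
  qed (rule assms(1))
qed

locale Spec_hom =
  fixes R :: "'a ring" and S :: "'b ring" and h :: "'a \<Rightarrow> 'b"
  assumes cring_R: "cring R" and cring_S: "cring S" and hom: "h \<in> ring_hom R S"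
begin

abbreviation "vim Q \<equiv> {a \<in> carrier R. h a \<in> Q}"

lemma points_S: "points (Spec S) = {Q. primeideal Q S}"
  and points_R: "points (Spec R) = {P. primeideal P R}"
  using cring_R cring_S by (simp_all add: points_Spec cring.axioms(1))

lemma base_Spec_map: "primeideal Q S \<Longrightarrow> base (Spec_map R S h) Q = vim Q"
  by (simp add: Spec_map_def points_S)

lemma preim_Spec_map: "preim (Spec S) (Spec_map R S h) V = {Q. primeideal Q S \<and> vim Q \<in> V}"
  by (auto simp: preim_def points_S base_Spec_map)

lemma vim_prime: "primeideal Q S \<Longrightarrow> primeideal (vim Q) R"
  using primeideal_vimage[OF cring_R cring_S hom] .

lemma open_preim_Spec_map:
  assumes "is_open (Spec R) V"
  shows "is_open (Spec S) (preim (Spec S) (Spec_map R S h) V)"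
proof -
  obtain E where E: "E \<subseteq> carrier R" "V = zariski_open R E"
    using assms unfolding is_open_Spec openin_zariski by blast
  have "preim (Spec S) (Spec_map R S h) V = zariski_open S (h ` E)"
    unfolding preim_Spec_map using E vim_prime by (auto simp: zariski_open_def)
  moreover have "h ` E \<subseteq> carrier S" using E ring_hom_closed[OF hom] by blast
  ultimately show ?thesis unfolding is_open_Spec openin_zariski by blast
qed

lemma vim_S: "h ` (carrier R - vim Q) \<subseteq> carrier S - Q"
proof (rule image_subsetI)
  fix x assume "x \<in> carrier R - vim Q"
  then show "h x \<in> carrier S - Q" using ring_hom_closed[OF hom, of x] by simp
qed

lemma frac_map_prime:
  assumes Q: "primeideal Q S"
  shows "\<lbrakk>a \<in> carrier R; f \<in> carrier R; f \<notin> vim Q\<rbrakk> \<Longrightarrow>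
      frac_map S (carrier S - Q) h (frac R (carrier R - vim Q) a f) = frac S (carrier S - Q) (h a) (h f)"
    and "frac_map S (carrier S - Q) h \<in>
      ring_hom (localization R (carrier R - vim Q)) (localization S (carrier S - Q))"
proof -
  interpret P: mult_subset R "carrier R - vim Q" using mult_subset_prime[OF vim_prime[OF Q]] .
  note Q' = mult_subset_prime[OF Q]
  show "frac_map S (carrier S - Q) h \<in>
      ring_hom (localization R (carrier R - vim Q)) (localization S (carrier S - Q))"
    by (rule P.frac_map_hom[OF Q' hom vim_S])
  show "frac_map S (carrier S - Q) h (frac R (carrier R - vim Q) a f) =
      frac S (carrier S - Q) (h a) (h f)" if "a \<in> carrier R" "f \<in> carrier R" "f \<notin> vim Q"
    by (rule P.frac_map_frac[OF Q' hom vim_S]) (use that in blast)+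
qed

lemma comap_Spec_map:
  assumes "is_open (Spec R) V" "\<sigma> \<in> spec_sections R V"
  shows "comap (Spec_map R S h) V \<sigma> =
    (\<lambda>Q\<in>preim (Spec S) (Spec_map R S h) V.
       frac_map S (carrier S - Q) h (\<sigma> (vim Q)))"
proof -
  have U: "preim (Spec S) (Spec_map R S h) V = {Q \<in> points (Spec S). vim Q \<in> V}"
    by (simp add: preim_Spec_map points_S)
  show ?thesis
    unfolding U using assms by (simp add: Spec_map_def Spec_simps frac_map_def)
qed

lemma comap_Spec_map_apply:
  assumes "is_open (Spec R) V" "\<sigma> \<in> spec_sections R V" "primeideal Q S" "vim Q \<in> V"
    "a \<in> carrier R" "f \<in> carrier R" "f \<notin> vim Q" "\<sigma> (vim Q) = frac R (carrier R - vim Q) a f"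
  shows "comap (Spec_map R S h) V \<sigma> Q = frac S (carrier S - Q) (h a) (h f)"
  using assms frac_map_prime(1)[of Q a f] by (simp add: comap_Spec_map preim_Spec_map)

lemma comap_Spec_map_closed:
  assumes V: "is_open (Spec R) V" and \<sigma>: "\<sigma> \<in> spec_sections R V"
  shows "comap (Spec_map R S h) V \<sigma> \<in> spec_sections S (preim (Spec S) (Spec_map R S h) V)"
  unfolding comap_Spec_map[OF assms]
proof (rule spec_sectionsI)
  fix Q assume "Q \<in> preim (Spec S) (Spec_map R S h) V"
  then have Q: "primeideal Q S" "vim Q \<in> V" by (simp_all add: preim_Spec_map)
  obtain W a f where W: "vim Q \<in> W" "W \<subseteq> V" "fraction_on R W a f \<sigma>"
    using spec_sections_localE[OF \<sigma> Q(2)] .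
  have "fraction_on S (preim (Spec S) (Spec_map R S h) W) (h a) (h f)
      (\<lambda>Q. frac_map S (carrier S - Q) h (\<sigma> (vim Q)))"
    unfolding fraction_on_def
  proof (intro conjI ballI)
    show "is_open (Spec S) (preim (Spec S) (Spec_map R S h) W)"
      using W(3) by (intro open_preim_Spec_map) (simp add: fraction_on_def)
    show "h a \<in> carrier S" "h f \<in> carrier S"
      using W(3) ring_hom_closed[OF hom] by (simp_all add: fraction_on_def)
    fix Q' assume "Q' \<in> preim (Spec S) (Spec_map R S h) W"
    then have Q': "primeideal Q' S" "vim Q' \<in> W" by (simp_all add: preim_Spec_map)
    note f = fraction_onD(2-5)[OF W(3)]
    show "h f \<notin> Q'" using f(2) f(3)[OF Q'(2)] by simp
    show "frac_map S (carrier S - Q') h (\<sigma> (vim Q')) =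
        frac S (carrier S - Q') (h a) (h f)"
      unfolding f(4)[OF Q'(2)] by (rule frac_map_prime(1)[OF Q'(1) f(1,2) f(3)[OF Q'(2)]])
  qed
  moreover have "Q \<in> preim (Spec S) (Spec_map R S h) W"
    using Q W(1) by (simp add: preim_Spec_map)
  moreover note preim_mono[OF W(2), of "Spec S" "Spec_map R S h"]
  ultimately show "\<exists>V' a f. Q \<in> V' \<and> V' \<subseteq> preim (Spec S) (Spec_map R S h) V \<and>
      fraction_on S V' a f (\<lambda>Q. frac_map S (carrier S - Q) h (\<sigma> (vim Q)))"
    by (intro exI conjI)
qed

lemma comap_Spec_map_hom:
  assumes V: "is_open (Spec R) V"
  shows "comap (Spec_map R S h) V \<in>
    ring_hom (sec (Spec R) V) (sec (Spec S) (preim (Spec S) (Spec_map R S h) V))"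
    (is "?h \<in> ring_hom _ (sec _ ?U)")
proof (rule ring_hom_memI)
  fix \<sigma> assume "\<sigma> \<in> carrier (sec (Spec R) V)"
  then show "?h \<sigma> \<in> carrier (sec (Spec S) ?U)"
    using comap_Spec_map_closed[OF V] by (simp add: Spec_simps)
next
  fix \<sigma> \<tau> assume "\<sigma> \<in> carrier (sec (Spec R) V)" "\<tau> \<in> carrier (sec (Spec R) V)"
  then have \<sigma>: "\<sigma> \<in> spec_sections R V" and \<tau>: "\<tau> \<in> spec_sections R V"
    by (simp_all add: Spec_simps)
  let ?m = "\<lambda>P\<in>V. \<sigma> P \<otimes>\<^bsub>localization R (carrier R - P)\<^esub> \<tau> P"
  let ?a = "\<lambda>P\<in>V. \<sigma> P \<oplus>\<^bsub>localization R (carrier R - P)\<^esub> \<tau> P"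
  note m = spec_sections_ops(1)[OF \<sigma> \<tau>] and a = spec_sections_ops(2)[OF \<sigma> \<tau>]
  note c\<sigma> = comap_Spec_map_closed[OF V \<sigma>] and c\<tau> = comap_Spec_map_closed[OF V \<tau>]
  have "?h ?m Q = ?h \<sigma> Q \<otimes>\<^bsub>localization S (carrier S - Q)\<^esub> ?h \<tau> Q \<and>
      ?h ?a Q = ?h \<sigma> Q \<oplus>\<^bsub>localization S (carrier S - Q)\<^esub> ?h \<tau> Q" if "Q \<in> ?U" for Q
  proof -
    have Q: "primeideal Q S" "vim Q \<in> V" using that by (simp_all add: preim_Spec_map)
    note fh = frac_map_prime(2)[OF Q(1)]
    have "\<sigma> (vim Q) \<in> carrier (localization R (carrier R - vim Q))"
      "\<tau> (vim Q) \<in> carrier (localization R (carrier R - vim Q))"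
      using spec_sections_apply \<sigma> \<tau> Q(2) by blast+
    then show ?thesis
      using that Q(2)
      by (simp add: comap_Spec_map[OF V] \<sigma> \<tau> m a ring_hom_mult[OF fh] ring_hom_add[OF fh])
  qed
  then show "?h (\<sigma> \<otimes>\<^bsub>sec (Spec R) V\<^esub> \<tau>) = ?h \<sigma> \<otimes>\<^bsub>sec (Spec S) ?U\<^esub> ?h \<tau>"
    "?h (\<sigma> \<oplus>\<^bsub>sec (Spec R) V\<^esub> \<tau>) = ?h \<sigma> \<oplus>\<^bsub>sec (Spec S) ?U\<^esub> ?h \<tau>"
    unfolding Spec_simps
    using spec_sections_ext[OF comap_Spec_map_closed[OF V m] spec_sections_ops(1)[OF c\<sigma> c\<tau>]]
      spec_sections_ext[OF comap_Spec_map_closed[OF V a] spec_sections_ops(2)[OF c\<sigma> c\<tau>]]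
    by simp_all
next
  interpret sR: cring "sec (Spec R) V" by (rule cring_sec_Spec[OF cring_R V])
  interpret sS: cring "sec (Spec S) ?U" by (rule cring_sec_Spec[OF cring_S open_preim_Spec_map[OF V]])
  have one: "\<one>\<^bsub>sec (Spec R) V\<^esub> \<in> spec_sections R V" "\<one>\<^bsub>sec (Spec S) ?U\<^esub> \<in> spec_sections S ?U"
    using sR.one_closed sS.one_closed by (simp_all only: Spec_simps)
  show "?h \<one>\<^bsub>sec (Spec R) V\<^esub> = \<one>\<^bsub>sec (Spec S) ?U\<^esub>"
  proof (rule spec_sections_ext[OF comap_Spec_map_closed[OF V one(1)] one(2)])
    fix Q assume U: "Q \<in> ?U"
    then have Q: "primeideal Q S" "vim Q \<in> V" by (simp_all add: preim_Spec_map)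
    then show "?h \<one>\<^bsub>sec (Spec R) V\<^esub> Q = \<one>\<^bsub>sec (Spec S) ?U\<^esub> Q"
      using U ring_hom_one[OF frac_map_prime(2)[OF Q(1)]]
      by (simp add: comap_Spec_map[OF V one(1)]) (simp add: Spec_simps)
  qed
qed

lemma presheaf_mor_Spec_map: "presheaf_mor (Spec S) (Spec R) (Spec_map R S h)"
  unfolding presheaf_mor_def
proof (intro conjI allI impI ballI)
  show "base (Spec_map R S h) \<in> extensional (points (Spec S))"
    "comap (Spec_map R S h) \<in> extensional {V. is_open (Spec R) V}"
    by (simp_all add: Spec_map_def)
  show "continuous_map (space_of (Spec S)) (space_of (Spec R)) (base (Spec_map R S h))"
    unfolding continuous_map_def
  proof (intro conjI allI impI funcsetI)
    fix Q assume "Q \<in> points (Spec S)"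
    then show "base (Spec_map R S h) Q \<in> points (Spec R)"
      by (simp add: points_S points_R base_Spec_map vim_prime)
  next
    fix V assume "is_open (Spec R) V"
    then show "is_open (Spec S) {Q \<in> points (Spec S). base (Spec_map R S h) Q \<in> V}"
      using open_preim_Spec_map by (simp add: preim_def)
  qed
next
  fix V assume V: "is_open (Spec R) V"
  show "comap (Spec_map R S h) V \<in> extensional (carrier (sec (Spec R) V))"
    using V by (simp add: Spec_map_def)
  show "comap (Spec_map R S h) V \<in>
      ring_hom (sec (Spec R) V) (sec (Spec S) (preim (Spec S) (Spec_map R S h) V))"
    by (rule comap_Spec_map_hom[OF V])
next
  fix V W \<sigma> assume VW: "is_open (Spec R) V \<and> is_open (Spec R) W \<and> W \<subseteq> V"
    and \<sigma>: "\<sigma> \<in> carrier (sec (Spec R) V)"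
  then have \<sigma>: "\<sigma> \<in> spec_sections R V" and \<tau>: "restrict \<sigma> W \<in> spec_sections R W"
    using spec_sections_restrict[of \<sigma> R V W] by (simp_all add: Spec_simps)
  have V: "is_open (Spec R) V" "is_open (Spec R) W" "W \<subseteq> V" using VW by simp_all
  show "comap (Spec_map R S h) W (res (Spec R) V W \<sigma>) =
      res (Spec S) (preim (Spec S) (Spec_map R S h) V) (preim (Spec S) (Spec_map R S h) W)
        (comap (Spec_map R S h) V \<sigma>)"
    unfolding Spec_simps comap_Spec_map[OF V(1) \<sigma>] comap_Spec_map[OF V(2) \<tau>] restrict_restrict
      Int_absorb1[OF preim_mono[OF V(3)]]
    by (intro restrict_ext) (simp add: preim_Spec_map)
qed

end

text \<open>At a prime \<open>Q\<close> of \<open>R\<close>, a fraction \<open>a / f\<close> goes to \<open>h a / h f\<close> and then to \<open>e (h a) / e (h f)\<close>,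
  which is \<open>a / f\<close> again.\<close>

lemma comp_Spec_map_retraction:
  assumes "Spec_hom R S h" "Spec_hom S R e" and eh: "\<And>a. a \<in> carrier R \<Longrightarrow> e (h a) = a"
  shows "comp_mor (Spec R) (Spec S) (Spec R) (Spec_map R S h) (Spec_map S R e) = id_mor (Spec R)"
proof -
  interpret H: Spec_hom R S h by fact
  interpret E: Spec_hom S R e by fact
  have vim: "H.vim (E.vim Q) = Q" if "primeideal Q R" for Q
  proof -
    interpret Q: primeideal Q R by fact
    show ?thesis using ring_hom_closed[OF H.hom] eh Q.a_subset by auto
  qed
  have pre: "preim (Spec R) (Spec_map S R e) (preim (Spec S) (Spec_map R S h) V) = V"
    if "is_open (Spec R) V" for V
    using prime_if_open[OF that] vim E.vim_prime by (auto simp: E.preim_Spec_map H.preim_Spec_map)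
  let ?c = "comp_mor (Spec R) (Spec S) (Spec R) (Spec_map R S h) (Spec_map S R e)"
  have "base ?c = base (id_mor (Spec R))"
  proof
    fix Q show "base ?c Q = base (id_mor (Spec R)) Q"
      using vim E.vim_prime
      by (simp add: comp_mor_def id_mor_def restrict_def H.points_R E.base_Spec_map H.base_Spec_map)
  qed
  moreover have "comap ?c V \<sigma> = comap (id_mor (Spec R)) V \<sigma>" for V \<sigma>
  proof (cases "is_open (Spec R) V \<and> \<sigma> \<in> spec_sections R V")
    case True
    then have V: "is_open (Spec R) V" and \<sigma>: "\<sigma> \<in> spec_sections R V" by auto
    let ?V = "preim (Spec S) (Spec_map R S h) V" and ?\<tau> = "comap (Spec_map R S h) V \<sigma>"
    have V': "is_open (Spec S) ?V" by (rule H.open_preim_Spec_map[OF V])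
    have \<tau>: "?\<tau> \<in> spec_sections S ?V" by (rule H.comap_Spec_map_closed[OF V \<sigma>])
    have "comap (Spec_map S R e) ?V ?\<tau> \<in> spec_sections R V"
      using E.comap_Spec_map_closed[OF V' \<tau>] by (simp add: pre[OF V])
    then have "comap (Spec_map S R e) ?V ?\<tau> = \<sigma>"
    proof (rule spec_sections_ext[OF _ \<sigma>])
      fix Q assume QV: "Q \<in> V"
      have Q: "primeideal Q R" using prime_if_open[OF V QV] .
      note eQ = E.vim_prime[OF Q]
      obtain W a f where W: "Q \<in> W" "W \<subseteq> V" "fraction_on R W a f \<sigma>"
        using spec_sections_localE[OF \<sigma> QV] .
      note f = fraction_onD(2,3)[OF W(3)] fraction_onD(4,5)[OF W(3) W(1)]
      have \<tau>Q: "?\<tau> (E.vim Q) = frac S (carrier S - E.vim Q) (h a) (h f)"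
        by (rule H.comap_Spec_map_apply[OF V \<sigma> eQ, unfolded vim[OF Q], OF QV f])
      have "H.vim (E.vim Q) \<in> V" by (subst vim[OF Q]) (rule QV)
      then have "E.vim Q \<in> ?V" unfolding H.preim_Spec_map by (intro CollectI conjI eQ)
      then have "comap (Spec_map S R e) ?V ?\<tau> Q = frac R (carrier R - Q) (e (h a)) (e (h f))"
        using E.comap_Spec_map_apply[OF V' \<tau> Q _ _ _ _ \<tau>Q] f ring_hom_closed[OF H.hom]
        by (simp add: eh)
      then show "comap (Spec_map S R e) ?V ?\<tau> Q = \<sigma> Q" using f by (simp add: eh)
    qed
    then show ?thesis using V \<sigma> by (simp add: comp_mor_def id_mor_def Spec_simps)
  next
    case False
    then show ?thesis by (auto simp: comp_mor_def id_mor_def Spec_simps)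
  qed
  then have "comap ?c = comap (id_mor (Spec R))" by (intro ext) simp
  ultimately show ?thesis by simp
qed

text \<open>Otherwise \<open>b / f\<close> would have the inverse \<open>f / b\<close> on the part of \<open>V\<close> where \<open>b\<close> does not vanish, and
  the maximal ideal would contain \<open>1\<close>.\<close>

lemma numerator_in_prime:
  assumes S: "cring S" and M: "maximalideal M (stalk (Spec S) P)" and U: "is_open (Spec S) U" "P \<in> U"
    and \<sigma>: "\<sigma> \<in> spec_sections S U" and germ: "germ (Spec S) P U \<sigma> \<in> M"
    and fr: "P \<in> V" "V \<subseteq> U" "fraction_on S V b f \<sigma>"
  shows "b \<in> P"
proof (rule ccontr)
  assume b: "b \<notin> P"
  interpret Sp: ring_presheaf "Spec S" by (rule ring_presheaf_Spec[OF S])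
  interpret M: maximalideal M "stalk (Spec S) P" by fact
  note V = fraction_onD(1)[OF fr(3)] and bf = fraction_onD(2-5)[OF fr(3)]
  let ?W = "V \<inter> zariski_open S {b}"
  have W: "is_open (Spec S) ?W"
    using V bf(1) openin_zariski[of S "zariski_open S {b}"] by (auto simp: is_open_Spec)
  have PW: "P \<in> ?W" "?W \<subseteq> U"
    using fr(1,2) b prime_if_open[OF U] by (auto simp: zariski_open_def)
  let ?\<tau> = "\<lambda>Q\<in>?W. frac S (carrier S - Q) f b"
  have \<tau>: "?\<tau> \<in> spec_sections S ?W"
    using W bf by (intro spec_sections_const) (auto simp: zariski_open_def)
  have "restrict \<sigma> ?W Q \<otimes>\<^bsub>localization S (carrier S - Q)\<^esub> ?\<tau> Q = \<one>\<^bsub>localization S (carrier S - Q)\<^esub>"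
    if Q: "Q \<in> ?W" for Q
  proof -
    interpret Q: mult_subset S "carrier S - Q" using mult_subset_prime[OF prime_if_open[OF W Q]] .
    have fQ: "f \<notin> Q" "b \<notin> Q" "\<sigma> Q = frac S (carrier S - Q) b f"
      using bf(3,4) Q by (auto simp: zariski_open_def)
    have "frac S (carrier S - Q) b f \<otimes>\<^bsub>localization S (carrier S - Q)\<^esub> frac S (carrier S - Q) f b =
        frac S (carrier S - Q) (b \<otimes>\<^bsub>S\<^esub> f) (f \<otimes>\<^bsub>S\<^esub> b)"
      using bf fQ by (simp add: Q.frac_mult)
    also have "\<dots> = frac S (carrier S - Q) \<one>\<^bsub>S\<^esub> \<one>\<^bsub>S\<^esub>"
      using bf(1,2) fQ Q.one_S Q.mult_S[of f b] by (intro Q.frac_eqI) (auto simp: Q.m_comm)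
    finally show ?thesis using Q fQ by (simp add: Q.localization_one)
  qed
  then have "restrict \<sigma> ?W \<otimes>\<^bsub>sec (Spec S) ?W\<^esub> ?\<tau> = \<one>\<^bsub>sec (Spec S) ?W\<^esub>"
    unfolding Spec_simps by (intro restrict_ext)
  moreover have \<sigma>W: "restrict \<sigma> ?W \<in> spec_sections S ?W"
    using spec_sections_restrict[OF \<sigma> W PW(2)] .
  moreover have "germ (Spec S) P U \<sigma> = germ (Spec S) P ?W (restrict \<sigma> ?W)"
    using Sp.germ_res[OF U(1) W PW] \<sigma> by (simp add: Spec_simps)
  ultimately have "germ (Spec S) P U \<sigma> \<otimes>\<^bsub>stalk (Spec S) P\<^esub> germ (Spec S) P ?W ?\<tau> =
      \<one>\<^bsub>stalk (Spec S) P\<^esub>"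
    using Sp.stalk_mult[OF W PW(1), of "restrict \<sigma> ?W" ?\<tau>] \<tau> Sp.stalk_one[OF W PW(1)]
    by (simp add: Spec_simps(1))
  moreover have "germ (Spec S) P ?W ?\<tau> \<in> carrier (stalk (Spec S) P)"
    using \<tau> by (intro Sp.germ_closed[OF W PW(1)]) (simp add: Spec_simps(1))
  ultimately have "\<one>\<^bsub>stalk (Spec S) P\<^esub> \<in> M" using M.I_r_closed[OF germ] by metis
  then show False using M.one_imp_carrier M.I_notcarr by blast
qed

text \<open>Since zero is the only prime ideal of \<open>k\<close>, the map \<open>e\<close> kills the numerators of germs in the
  maximal ideal. Such germs therefore become zero already on \<open>Spec k\<close>, so that locality of the
  composite does not depend on the maximal ideals of the intermediate stalk.\<close>

lemma Mor_comp_Spec_map_field: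
  assumes k: "field k" and e: "Spec_hom S k e" and Z: "locally_ringed_space Z" and f: "f \<in> Mor Z (Spec k)"
  shows "comp_mor Z (Spec k) (Spec S) (Spec_map S k e) f \<in> Mor Z (Spec S)"
proof -
  interpret k: field k by fact
  interpret E: Spec_hom S k e by fact
  interpret Z: locally_ringed_space Z by fact
  note pZ = Z.ring_presheaf_axioms
  note pS = ring_presheaf_Spec[OF E.cring_R]
  interpret Sp: ring_presheaf "Spec S" by (rule pS)
  have f': "presheaf_mor Z (Spec k) f" using f by (simp add: Mor_iff)
  note e' = E.presheaf_mor_Spec_map
  let ?c = "comp_mor Z (Spec k) (Spec S) (Spec_map S k e) f"
  note c = presheaf_mor_comp[OF pS f' e']
  have "local_hom (stalk (Spec S) (base ?c x)) (stalk Z x) (stalk_map Z ?c x)" if x: "x \<in> points Z" for x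
    unfolding local_hom_def
  proof (intro conjI allI impI subsetI)
    show "stalk_map Z ?c x \<in> ring_hom (stalk (Spec S) (base ?c x)) (stalk Z x)"
      using stalk_map_ring_hom[OF pZ pS c x] .
    fix M N y assume MN: "maximalideal M (stalk (Spec S) (base ?c x)) \<and> maximalideal N (stalk Z x)"
      and "y \<in> stalk_map Z ?c x ` M"
    then obtain a where a: "a \<in> M" "y = stalk_map Z ?c x a" by blast
    interpret N: maximalideal N "stalk Z x" using MN by simp
    define Q where "Q = base f x"
    have Q: "primeideal Q k"
      using presheaf_morD(7)[OF f' x] by (simp add: Q_def points_Spec k.ring_axioms)
    let ?P = "E.vim Q"
    have bc: "base ?c x = ?P" using Q x by (simp add: base_comp E.base_Spec_map Q_def)
    have M: "maximalideal M (stalk (Spec S) ?P)" using MN by (simp add: bc)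
    interpret M: maximalideal M "stalk (Spec S) ?P" by (rule M)
    have aS: "a \<in> carrier (stalk (Spec S) ?P)" using a M.a_subset by blast
    obtain U \<sigma> where U: "is_open (Spec S) U" "?P \<in> U" "\<sigma> \<in> carrier (sec (Spec S) U)"
      and a': "a = germ (Spec S) ?P U \<sigma>" using Sp.stalkE[OF aS] .
    then have \<sigma>: "\<sigma> \<in> spec_sections S U" by (simp add: Spec_simps)
    obtain V b g where V: "?P \<in> V" "V \<subseteq> U" "fraction_on S V b g \<sigma>"
      using spec_sections_localE[OF \<sigma> U(2)] .
    have b: "b \<in> ?P"
      using numerator_in_prime[OF E.cring_R M U(1,2) \<sigma> _ V] a(1) by (simp add: a')
    have prime_k: "P = {\<zero>\<^bsub>k\<^esub>}" if "primeideal P k" for P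
    proof -
      interpret P: primeideal P k by fact
      show ?thesis using k.all_ideals P.is_ideal P.I_notcarr by blast
    qed
    have "e b = \<zero>\<^bsub>k\<^esub>" using b prime_k[OF Q] by auto
    let ?U = "preim (Spec k) (Spec_map S k e) U" and ?\<tau> = "comap (Spec_map S k e) U \<sigma>"
    have Uo: "is_open (Spec k) ?U" by (rule E.open_preim_Spec_map[OF U(1)])
    interpret sk: cring "sec (Spec k) ?U" by (rule cring_sec_Spec[OF k.is_cring Uo])
    have "?\<tau> = \<zero>\<^bsub>sec (Spec k) ?U\<^esub>"
    proof (rule spec_sections_ext[OF E.comap_Spec_map_closed[OF U(1) \<sigma>]])
      show "\<zero>\<^bsub>sec (Spec k) ?U\<^esub> \<in> spec_sections k ?U"
        using sk.zero_closed by (simp only: Spec_simps(1))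
      fix Q' assume Q': "Q' \<in> ?U"
      then have "primeideal Q' k" by (simp add: E.preim_Spec_map)
      then have Q'Q: "Q' = Q" using prime_k[of Q'] prime_k[OF Q] by simp
      interpret Q: mult_subset k "carrier k - Q" using mult_subset_prime[OF Q] .
      note g = fraction_onD(2,3)[OF V(3)] fraction_onD(4,5)[OF V(3) V(1)]
      have "?\<tau> Q = frac k (carrier k - Q) (e b) (e g)"
        by (rule E.comap_Spec_map_apply[OF U(1) \<sigma> Q U(2) g])
      also have "\<dots> = \<zero>\<^bsub>localization k (carrier k - Q)\<^esub>"
        using g ring_hom_closed[OF E.hom, of g] \<open>e b = \<zero>\<^bsub>k\<^esub>\<close> by (simp add: Q.frac_zero)
      finally show "?\<tau> Q' = \<zero>\<^bsub>sec (Spec k) ?U\<^esub> Q'"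
        using Q' by (simp add: Q'Q Spec_simps)
    qed
    have UU: "is_open Z (preim Z f ?U)" using presheaf_morD(8)[OF f' Uo] .
    have xU: "x \<in> preim Z f ?U" using x Q U(2) by (simp add: preim_def[of Z] E.preim_Spec_map Q_def[symmetric])
    interpret sZ: cring "sec Z (preim Z f ?U)" by (rule Z.cring_sec[OF UU])
    let ?z = "comap f ?U \<zero>\<^bsub>sec (Spec k) ?U\<^esub>"
    have z: "?z = \<zero>\<^bsub>sec Z (preim Z f ?U)\<^esub>"
      by (rule ring_hom_zero[OF presheaf_morD(5)[OF f' Uo] sk.ring_axioms sZ.ring_axioms])
    have "y = germ Z x (preim Z ?c U) (comap ?c U \<sigma>)"
      using stalk_map_germ[OF pZ pS c x U(1) _ U(3)] U(2) by (simp add: a(2) a' bc)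
    also have "\<dots> = germ Z x (preim Z f ?U) \<zero>\<^bsub>sec Z (preim Z f ?U)\<^esub>"
      using \<open>?\<tau> = _\<close> z U by (simp add: preim_comp[OF f'] comap_comp)
    finally have y: "y = germ Z x (preim Z f ?U) \<zero>\<^bsub>sec Z (preim Z f ?U)\<^esub>" .
    have yc: "y \<in> carrier (stalk Z x)"
      unfolding y by (rule Z.germ_closed[OF UU xU sZ.zero_closed])
    have yy: "y \<oplus>\<^bsub>stalk Z x\<^esub> y = y"
      unfolding y using Z.stalk_add[OF UU xU sZ.zero_closed sZ.zero_closed] by simp
    have "y = (\<ominus>\<^bsub>stalk Z x\<^esub> y \<oplus>\<^bsub>stalk Z x\<^esub> y) \<oplus>\<^bsub>stalk Z x\<^esub> y"
      by (simp add: yc N.l_neg)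
    also have "\<dots> = \<zero>\<^bsub>stalk Z x\<^esub>"
      by (simp add: yc N.a_assoc yy) (simp add: yc N.l_neg)
    finally show "y \<in> N" by simp
  qed
  then show ?thesis using c by (simp add: Mor_iff)
qed

section \<open>Truncated polynomials\<close>

text \<open>A homomorphism vanishing on \<open>I\<close> is constant on cosets, hence factors through the quotient.\<close>

lemma the_elem_coset:
  assumes "ideal I R" "ring S" and f: "f \<in> ring_hom R S" and I: "\<And>a. a \<in> I \<Longrightarrow> f a = \<zero>\<^bsub>S\<^esub>"
    and a: "a \<in> carrier R"
  shows "the_elem (f ` (I +>\<^bsub>R\<^esub> a)) = f a"
proof -
  interpret I: ideal I R by fact
  interpret S: ring S by fact
  have fa: "f a \<in> carrier S" using ring_hom_closed[OF f a] .
  have "f (i \<oplus>\<^bsub>R\<^esub> a) = f a" if "i \<in> I" for i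
    using that I fa a by (simp add: ring_hom_add[OF f] I.Icarr)
  then have "f x = f a" if "x \<in> I +>\<^bsub>R\<^esub> a" for x
    using that by (auto simp: a_r_coset_def')
  moreover have "a \<in> I +>\<^bsub>R\<^esub> a" using I.a_rcos_self[OF a] .
  ultimately have "f ` (I +>\<^bsub>R\<^esub> a) = {f a}" by blast
  then show ?thesis by simp
qed

lemma quotient_hom:
  assumes I: "ideal I R" and S: "ring S" and f: "f \<in> ring_hom R S" and I0: "\<And>a. a \<in> I \<Longrightarrow> f a = \<zero>\<^bsub>S\<^esub>"
  shows "(\<lambda>C. the_elem (f ` C)) \<in> ring_hom (R Quot I) S"
proof -
  interpret I: ideal I R by fact
  note el = the_elem_coset[OF assms]
  note q = I.rcos_ring_hom
  have Quot: "\<exists>a\<in>carrier R. C = I +>\<^bsub>R\<^esub> a" if "C \<in> carrier (R Quot I)" for C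
    using that by (auto simp: FactRing_def A_RCOSETS_def')
  show ?thesis
  proof (rule ring_hom_memI)
    fix C assume "C \<in> carrier (R Quot I)"
    then show "the_elem (f ` C) \<in> carrier S" using Quot el ring_hom_closed[OF f] by metis
  next
    fix C D assume "C \<in> carrier (R Quot I)" "D \<in> carrier (R Quot I)"
    then obtain a b where ab: "a \<in> carrier R" "b \<in> carrier R" "C = I +>\<^bsub>R\<^esub> a" "D = I +>\<^bsub>R\<^esub> b"
      using Quot by metis
    show "the_elem (f ` (C \<otimes>\<^bsub>R Quot I\<^esub> D)) = the_elem (f ` C) \<otimes>\<^bsub>S\<^esub> the_elem (f ` D)"
      using ab el[of "a \<otimes>\<^bsub>R\<^esub> b"] ring_hom_mult[OF q ab(1,2)] by (simp add: el ring_hom_mult[OF f])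
    show "the_elem (f ` (C \<oplus>\<^bsub>R Quot I\<^esub> D)) = the_elem (f ` C) \<oplus>\<^bsub>S\<^esub> the_elem (f ` D)"
      using ab el[of "a \<oplus>\<^bsub>R\<^esub> b"] ring_hom_add[OF q ab(1,2)] by (simp add: el ring_hom_add[OF f])
  next
    show "the_elem (f ` \<one>\<^bsub>R Quot I\<^esub>) = \<one>\<^bsub>S\<^esub>"
      using el[of "\<one>\<^bsub>R\<^esub>"] ring_hom_one[OF q] by (simp add: ring_hom_one[OF f])
  qed
qed

text \<open>The homomorphism \<open>k[t]/(t\<^sup>m\<^sup>+\<^sup>1) \<rightarrow> k\<close> with \<open>t \<mapsto> 0\<close>.\<close>

definition trunc_eval0 :: "'k ring \<Rightarrow> 'k list set \<Rightarrow> 'k" where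
  "trunc_eval0 k C = the_elem ((\<lambda>p. ring.eval k p \<zero>\<^bsub>k\<^esub>) ` C)"

lemma trunc_retraction:
  assumes "field k"
  shows "Spec_hom k (trunc_ring k m) (trunc_const k m)"
    and "Spec_hom (trunc_ring k m) k (trunc_eval0 k)"
    and "a \<in> carrier k \<Longrightarrow> trunc_eval0 k (trunc_const k m a) = a"
proof -
  interpret k: field k by fact
  let ?P = "poly_ring k" and ?I = "trunc_ideal k m" and ?ev = "\<lambda>p. k.eval p \<zero>\<^bsub>k\<^esub>"
  interpret P: cring ?P by (rule k.univ_poly_is_cring[OF k.carrier_is_subring])
  have X: "var k \<in> carrier ?P" by (rule k.var_closed(1)[OF k.carrier_is_subring])
  then have Xn: "var k [^]\<^bsub>?P\<^esub> n \<in> carrier ?P" for n :: nat by simp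
  interpret I: ideal ?I ?P
    unfolding trunc_ideal_def by (rule P.cgenideal_ideal[OF Xn])
  have ev: "?ev \<in> ring_hom ?P k"
    by (rule k.eval_is_hom[OF k.carrier_is_subring k.zero_closed])
  have ev0: "?ev p = \<zero>\<^bsub>k\<^esub>" if p: "p \<in> ?I" for p
  proof -
    let ?x = "var k [^]\<^bsub>?P\<^esub> m"
    obtain q where q: "q \<in> carrier ?P" and p: "p = q \<otimes>\<^bsub>?P\<^esub> (var k [^]\<^bsub>?P\<^esub> Suc m)"
      using p unfolding trunc_ideal_def cgenideal_def by blast
    have "?ev p = ?ev q \<otimes>\<^bsub>k\<^esub> ?ev (?x \<otimes>\<^bsub>?P\<^esub> var k)"
      unfolding p P.nat_pow_Suc by (rule ring_hom_mult[OF ev q P.m_closed[OF Xn X]])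
    also have "?ev (?x \<otimes>\<^bsub>?P\<^esub> var k) = ?ev ?x \<otimes>\<^bsub>k\<^esub> ?ev (var k)"
      by (rule ring_hom_mult[OF ev Xn X])
    also have "?ev (var k) = \<zero>\<^bsub>k\<^esub>" by (rule k.eval_var) simp
    finally show ?thesis
      using ring_hom_closed[OF ev q] ring_hom_closed[OF ev Xn[of m]] by simp
  qed
  have T: "cring (trunc_ring k m)"
    unfolding trunc_ring_def by (rule I.quotient_is_cring[OF P.is_cring])
  have const: "k.poly_of_const \<in> ring_hom k ?P"
    using k.canonical_embedding_is_hom[OF k.carrier_is_subring] by simp
  have "trunc_const k m = (+>\<^bsub>?P\<^esub>) ?I \<circ> k.poly_of_const"
    by (auto simp: trunc_const_def)
  then have "trunc_const k m \<in> ring_hom k (trunc_ring k m)"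
    using ring_hom_trans[OF const I.rcos_ring_hom] by (simp add: trunc_ring_def)
  then show "Spec_hom k (trunc_ring k m) (trunc_const k m)"
    using T k.is_cring by (intro Spec_hom.intro)
  have "trunc_eval0 k = (\<lambda>C. the_elem (?ev ` C))" by (auto simp: trunc_eval0_def)
  then have "trunc_eval0 k \<in> ring_hom (trunc_ring k m) k"
    using quotient_hom[OF I.is_ideal k.ring_axioms ev ev0] by (simp add: trunc_ring_def)
  then show "Spec_hom (trunc_ring k m) k (trunc_eval0 k)"
    using T k.is_cring by (intro Spec_hom.intro)
  assume a: "a \<in> carrier k"
  have "trunc_eval0 k (trunc_const k m a) = ?ev (k.poly_of_const a)"
    unfolding trunc_eval0_def trunc_const_def
    by (rule the_elem_coset[OF I.is_ideal k.ring_axioms ev ev0 ring_hom_closed[OF const a]])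
  also have "\<dots> = a"
    using a by (auto simp: k.poly_of_const_def)
  finally show "trunc_eval0 k (trunc_const k m a) = a" .
qed

section \<open>Retracts of rings\<close>

locale ring_retract =
  fixes A :: "'a ring" and B :: "'b ring" and \<phi> :: "'a \<Rightarrow> 'b" and \<psi> :: "'b \<Rightarrow> 'a"
  assumes cring_A: "cring A" and cring_B: "cring B"
    and \<phi>: "\<phi> \<in> ring_hom A B" and \<psi>: "\<psi> \<in> ring_hom B A"
    and retract: "a \<in> carrier A \<Longrightarrow> \<psi> (\<phi> a) = a"
begin

sublocale A: cring A by (rule cring_A)
sublocale B: cring B by (rule cring_B)
sublocale \<phi>: ring_hom_cring A B \<phi> by unfold_locales (rule \<phi>)
sublocale \<psi>: ring_hom_cring B A \<psi> by unfold_locales (rule \<psi>)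

lemma inj: "\<lbrakk>a \<in> carrier A; b \<in> carrier A; \<phi> a = \<phi> b\<rbrakk> \<Longrightarrow> a = b"
  using retract by metis

lemma zero_iff: "a \<in> carrier A \<Longrightarrow> \<phi> a = \<zero>\<^bsub>B\<^esub> \<longleftrightarrow> a = \<zero>\<^bsub>A\<^esub>"
  using inj[of a "\<zero>\<^bsub>A\<^esub>"] by auto

lemma reduced_retract:
  assumes "reduced_ring B"
  shows "reduced_ring A"
  unfolding reduced_ring_def
proof (intro conjI ballI allI impI)
  fix a n assume a: "a \<in> carrier A" "a [^]\<^bsub>A\<^esub> (n::nat) = \<zero>\<^bsub>A\<^esub>"
  then have "\<phi> a [^]\<^bsub>B\<^esub> n = \<zero>\<^bsub>B\<^esub>"
    by (metis \<phi>.hom_zero \<phi>.ring.hom_nat_pow)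
  then have "\<phi> a = \<zero>\<^bsub>B\<^esub>" using assms a(1) unfolding reduced_ring_def by blast
  then show "a = \<zero>\<^bsub>A\<^esub>" using a(1) zero_iff by simp
qed (rule cring_A)

lemma domain_retract:
  assumes "domain B"
  shows "domain A"
proof -
  interpret B: domain B by fact
  show ?thesis
  proof (intro domain.intro domain_axioms.intro)
    show "\<one>\<^bsub>A\<^esub> \<noteq> \<zero>\<^bsub>A\<^esub>" using \<phi>.hom_one \<phi>.hom_zero B.one_not_zero by metis
    fix a b assume ab: "a \<otimes>\<^bsub>A\<^esub> b = \<zero>\<^bsub>A\<^esub>" "a \<in> carrier A" "b \<in> carrier A"
    then have "\<phi> a \<otimes>\<^bsub>B\<^esub> \<phi> b = \<zero>\<^bsub>B\<^esub>" by (simp flip: \<phi>.hom_mult)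
    then show "a = \<zero>\<^bsub>A\<^esub> \<or> b = \<zero>\<^bsub>A\<^esub>"
      using B.integral[of "\<phi> a" "\<phi> b"] ab zero_iff by auto
  qed (rule cring_A)
qed

text \<open>An integral equation for \<open>x = a / s\<close> over \<open>A\<close> is carried by \<open>\<phi>\<close> to one over \<open>B\<close>, so normality of
  \<open>B\<close> gives \<open>\<phi> a = \<phi> s \<cdot> c\<close>. Applying \<open>\<psi>\<close> yields \<open>a = s \<cdot> \<psi> c\<close>.\<close>

lemma normal_retract:
  assumes "normal_domain B"
  shows "normal_domain A"
proof -
  have dB: "domain B" using assms by (simp add: normal_domain_def)
  have dA: "domain A" by (rule domain_retract[OF dB])
  interpret dA: domain A by (rule dA)
  interpret dB: domain B by (rule dB)
  let ?S = "carrier A - {\<zero>\<^bsub>A\<^esub>}" and ?T = "carrier B - {\<zero>\<^bsub>B\<^esub>}"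
  interpret FA: mult_subset A ?S by unfold_locales (auto simp: dA.integral_iff)
  interpret FB: mult_subset B ?T by unfold_locales (auto simp: dB.integral_iff)
  let ?F = "fraction_field A" and ?G = "fraction_field B"
  interpret F: cring ?F using FA.cring_localization by (simp add: fraction_field_def)
  interpret G: cring ?G using FB.cring_localization by (simp add: fraction_field_def)
  let ?f = "frac_map B ?T \<phi>"
  have ST: "\<phi> ` ?S \<subseteq> ?T" using zero_iff by auto
  have f: "?f \<in> ring_hom ?F ?G"
    using FA.frac_map_hom[OF FB.mult_subset_axioms \<phi> ST] by (simp add: fraction_field_def)
  note f_frac = FA.frac_map_frac[OF FB.mult_subset_axioms \<phi> ST]
  interpret f: ring_hom_ring ?F ?G ?f by unfold_locales (rule f)
  have tF: "to_fraction_field A a \<in> carrier ?F" if "a \<in> carrier A" for a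
    using that FA.one_S by (simp add: to_fraction_field_def fraction_field_def FA.frac_closed)
  have ft: "?f (to_fraction_field A a) = to_fraction_field B (\<phi> a)" if "a \<in> carrier A" for a
    using that FA.one_S by (simp add: to_fraction_field_def f_frac)
  have one_neq: "\<one>\<^bsub>?G\<^esub> \<noteq> \<zero>\<^bsub>?G\<^esub>"
    using FB.one_S dB.integral_iff
    by (auto simp: fraction_field_def FB.localization_one FB.localization_zero FB.frac_eq_iff)
  have "x \<in> to_fraction_field A ` carrier A"
    if x: "x \<in> carrier ?F" and int: "integral_over ?F (to_fraction_field A ` carrier A) x" for x
  proof -
    let ?K = "to_fraction_field A ` carrier A" and ?K' = "to_fraction_field B ` carrier B"
    obtain p where p: "p \<in> carrier (univ_poly ?F ?K)" "p \<noteq> []" "hd p = \<one>\<^bsub>?F\<^esub>"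
      "F.eval p x = \<zero>\<^bsub>?F\<^esub>" using int by (auto simp: integral_over_def)
    have pK: "set p \<subseteq> ?K" using p(1) by (auto simp: univ_poly_def polynomial_def)
    have "G.eval (map ?f p) (?f x) = \<zero>\<^bsub>?G\<^esub>"
    proof -
      have "set p \<subseteq> carrier ?F" using pK tF by auto
      from f.eval_hom'[OF x this] show ?thesis by (simp add: p(4))
    qed
    moreover have "?f y \<in> ?K'" if "y \<in> set p" for y
    proof -
      have "y \<in> ?K" using pK that by (rule subsetD)
      then obtain a where a: "y = to_fraction_field A a" "a \<in> carrier A" by (rule imageE)
      have "\<phi> a \<in> carrier B" using a(2) by simp
      then show ?thesis unfolding a(1) ft[OF a(2)] by (rule imageI)
    qed
    then have "set (map ?f p) \<subseteq> ?K'" by auto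
    moreover have hd: "hd (map ?f p) = \<one>\<^bsub>?G\<^esub>" using p(2,3) by (simp add: hd_map)
    ultimately have "integral_over ?G ?K' (?f x)"
      using p(2) one_neq unfolding integral_over_def
      by (intro bexI[of _ "map ?f p"]) (auto simp: univ_poly_def polynomial_def)
    moreover have "?f x \<in> carrier ?G" using x by simp
    ultimately have "?f x \<in> ?K'" using assms by (simp add: normal_domain_def)
    then obtain c where c: "c \<in> carrier B" "?f x = frac B ?T c \<one>\<^bsub>B\<^esub>"
      by (auto simp: to_fraction_field_def)
    obtain a s where as: "a \<in> carrier A" "s \<in> ?S" "x = frac A ?S a s"
      using x FA.localizationE by (auto simp: fraction_field_def)
    have s: "\<phi> s \<in> ?T" using as(2) ST by blast
    have "frac B ?T (\<phi> a) (\<phi> s) = frac B ?T c \<one>\<^bsub>B\<^esub>"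
      using c(2) f_frac as by simp
    then obtain u where u: "u \<in> ?T" "u \<otimes>\<^bsub>B\<^esub> (\<one>\<^bsub>B\<^esub> \<otimes>\<^bsub>B\<^esub> \<phi> a) = u \<otimes>\<^bsub>B\<^esub> (\<phi> s \<otimes>\<^bsub>B\<^esub> c)"
      using FB.frac_eq_iff[OF _ s c(1) FB.one_S] as(1) by auto
    then have "\<phi> a = \<phi> s \<otimes>\<^bsub>B\<^esub> c"
      using dB.m_lcancel[of u "\<phi> a" "\<phi> s \<otimes>\<^bsub>B\<^esub> c"] as c by auto
    then have "\<psi> (\<phi> a) = \<psi> (\<phi> s) \<otimes>\<^bsub>A\<^esub> \<psi> c" using as c by simp
    then have "a = s \<otimes>\<^bsub>A\<^esub> \<psi> c" using as retract by simp
    then have "x = frac A ?S (\<psi> c) \<one>\<^bsub>A\<^esub>"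
      unfolding as(3) using as c FA.one_S by (intro FA.frac_eqI) auto
    then show ?thesis using c(1) by (auto simp: to_fraction_field_def)
  qed
  then show ?thesis using dA by (simp add: normal_domain_def)
qed

end

section \<open>Retracts of locally ringed spaces\<close>

locale space_retract =
  fixes X :: "('p, 'r) rspace" and Y :: "('q, 's) rspace"
    and i :: "('p, 'r, 'q, 's) mor" and r :: "('q, 's, 'p, 'r) mor"
  assumes X: "locally_ringed_space X" and Y: "locally_ringed_space Y"
    and i: "i \<in> Mor X Y" and r: "r \<in> Mor Y X" and ri: "comp_mor X Y X r i = id_mor X"
begin

sublocale X: locally_ringed_space X by (rule X)
sublocale Y: locally_ringed_space Y by (rule Y)

lemma i': "presheaf_mor X Y i" and r': "presheaf_mor Y X r"
  using i r by (auto simp: Mor_iff)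

lemma base_ri: "x \<in> points X \<Longrightarrow> base r (base i x) = x"
  using base_comp[of x X Y X r i] by (simp add: ri) (simp add: id_mor_def)

lemma base_r_image: "base r ` points Y = points X"
proof
  show "base r ` points Y \<subseteq> points X" using presheaf_morD(7)[OF r'] by blast
  show "points X \<subseteq> base r ` points Y"
  proof
    fix x assume "x \<in> points X"
    then have "base i x \<in> points Y" "x = base r (base i x)"
      using presheaf_morD(7)[OF i'] base_ri by simp_all
    then show "x \<in> base r ` points Y" by (rule rev_image_eqI)
  qed
qed

lemma sec_retract:
  assumes U: "is_open X U"
  shows "ring_retract (sec X U) (sec Y (preim Y r U)) (comap r U) (comap i (preim Y r U))"
proof (rule ring_retract.intro)
  have U': "is_open Y (preim Y r U)" using presheaf_morD(8)[OF r' U] .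
  have pre: "preim X i (preim Y r U) = U"
    using preim_comp[OF i', of X r U] preim_id[OF openin_subset[OF U]] by (simp add: ri)
  show "comap i (preim Y r U) \<in> ring_hom (sec Y (preim Y r U)) (sec X U)"
    using presheaf_morD(5)[OF i' U'] by (simp add: pre)
  show "comap r U \<in> ring_hom (sec X U) (sec Y (preim Y r U))" using presheaf_morD(5)[OF r' U] .
  show "cring (sec X U)" "cring (sec Y (preim Y r U))"
    using X.cring_sec[OF U] Y.cring_sec[OF U'] .
  fix s assume s: "s \<in> carrier (sec X U)"
  show "comap i (preim Y r U) (comap r U s) = s"
    using comap_comp[OF U s, of X Y r i] s U by (simp add: ri) (simp add: id_mor_def)
qed

lemma stalk_retract:
  assumes x: "x \<in> points X"
  shows "ring_retract (stalk X x) (stalk Y (base i x))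
    (stalk_map Y r (base i x)) (stalk_map X i x)"
proof (rule ring_retract.intro)
  note pX = X.ring_presheaf_axioms and pY = Y.ring_presheaf_axioms
  have ix: "base i x \<in> points Y" using presheaf_morD(7)[OF i' x] .
  show "cring (stalk X x)" "cring (stalk Y (base i x))"
    using X.local_stalks[OF x] Y.local_stalks[OF ix] by (simp_all add: local_ring_def)
  show "stalk_map Y r (base i x) \<in> ring_hom (stalk X x) (stalk Y (base i x))"
    using stalk_map_ring_hom[OF pY pX r' ix] by (simp add: base_ri[OF x])
  show "stalk_map X i x \<in> ring_hom (stalk Y (base i x)) (stalk X x)"
    by (rule stalk_map_ring_hom[OF pX pY i' x])
  fix a assume a: "a \<in> carrier (stalk X x)"
  show "stalk_map X i x (stalk_map Y r (base i x) a) = a"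
    using stalk_map_comp[OF pX pY pX i' r' x, of a] stalk_map_id[OF pX x a] a
    by (simp add: base_ri[OF x] ri)
qed

lemma reduced_base: "reduced Y \<Longrightarrow> reduced X"
  unfolding reduced_def
  using ring_retract.reduced_retract[OF sec_retract] presheaf_morD(8)[OF r'] by simp

lemma connected_base: "connected_space (space_of Y) \<Longrightarrow> connected_space (space_of X)"
  using connectedin_continuous_map_image[OF presheaf_morD(4)[OF r'], of "points Y"]
  by (simp add: base_r_image connectedin_topspace)

lemma irreducible_base:
  assumes Y: "irreducible_space (space_of Y)"
  shows "irreducible_space (space_of X)"
  unfolding irreducible_space_def
proof (intro conjI allI impI)
  show "points X \<noteq> {}" using Y base_r_image by (auto simp: irreducible_space_def)
  fix A B assume AB: "closedin (space_of X) A \<and> closedin (space_of X) B \<and> A \<union> B = points X"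
  let ?p = "\<lambda>A. {y \<in> points Y. base r y \<in> A}"
  note cl = closedin_continuous_map_preimage[OF presheaf_morD(4)[OF r']]
  have "closedin (space_of Y) (?p A)" "closedin (space_of Y) (?p B)"
    using AB cl by blast+
  moreover have "?p A \<union> ?p B = points Y" using AB presheaf_morD(7)[OF r'] by auto
  ultimately have "?p A = points Y \<or> ?p B = points Y"
    using Y unfolding irreducible_space_def by blast
  moreover have "C = points X" if "?p C = points Y" "C \<subseteq> points X" for C
  proof
    have "base r ` points Y \<subseteq> C" using that(1) by (auto simp: set_eq_iff)
    then show "points X \<subseteq> C" by (simp add: base_r_image)
  qed (rule that(2))
  ultimately show "A = points X \<or> B = points X" using AB by blast
qed

lemma locally_integral_base: "locally_integral Y \<Longrightarrow> locally_integral X"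
  unfolding locally_integral_def
  using ring_retract.domain_retract[OF stalk_retract] presheaf_morD(7)[OF i'] by simp

lemma normal_base: "normal_scheme Y \<Longrightarrow> normal_scheme X"
  unfolding normal_scheme_def
  using ring_retract.normal_retract[OF stalk_retract] presheaf_morD(7)[OF i'] by simp

end

section \<open>Constant jets and base points of jets\<close>

text \<open>Here \<open>s\<close> is the morphism of constant jets, \<open>ev\<close> is the universal jet, and \<open>zY\<close>, \<open>zJ\<close> are the
  sections \<open>t = 0\<close> of the projections from \<open>Y \<times> D\<close> and \<open>J \<times> D\<close>. With \<open>h = s \<times> id\<close>, naturality reads
  \<open>ev \<circ> h = p\<close> and the universal property of \<open>J \<times> D\<close> gives \<open>h \<circ> zY = zJ \<circ> s\<close>, whence
  \<open>(ev \<circ> zJ) \<circ> s = ev \<circ> h \<circ> zY = p \<circ> zY = id\<close>.\<close>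

lemma jet_retract:
  fixes k :: "'k ring" and Y J :: "('p, 'r, 'k) over_Spec"
  assumes k: "field k" and Y: "finite_type_over k Y" and jet: "jet_scheme k m Y J"
  obtains i r where "space_retract (fst Y) (fst J) i r"
proof -
  interpret k: field k by fact
  let ?S = "Spec k" and ?D = "Spec (trunc_ring k m)"
  let ?b = "Spec_map k (trunc_ring k m) (trunc_const k m)"
  let ?e = "Spec_map (trunc_ring k m) k (trunc_eval0 k)"
  have T: "fst (trunc_Spec k m) = ?D" "snd (trunc_Spec k m) = ?b" by (simp_all add: trunc_Spec_def)
  note tr = trunc_retraction[OF k, where m = m]
  have J: "finite_type_over k J" using jet by (simp add: jet_scheme_def)
  have sY: "scheme_over k Y" and sJ: "scheme_over k J" using Y J by (simp_all add: finite_type_over_def)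
  then have lY: "locally_ringed_space (fst Y)" and lJ: "locally_ringed_space (fst J)"
    and aJ: "snd J \<in> Mor (fst J) ?S"
    by (simp_all add: scheme_over_def scheme_def)
  have pS: "ring_presheaf ?S" by (rule ring_presheaf_Spec[OF k.is_cring])
  have M: "presheaf_mor A B f" if "f \<in> Mor A B" for A B f using that by (simp add: Mor_iff)
  have pre: "ring_presheaf Z" if "locally_ringed_space Z" for Z
  proof -
    interpret locally_ringed_space Z by (rule that)
    show ?thesis by (rule ring_presheaf_axioms)
  qed
  have "\<exists>(P :: ('p, 'r, 'k) over_Spec \<Rightarrow> ('p, 'r) rspace) p q
        (\<Phi> :: ('p, 'r, 'k) over_Spec \<Rightarrow> ('p, 'r, 'p, 'r) mor \<Rightarrow> ('p, 'r, 'p, 'r) mor).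
      (\<forall>Z. scheme_over k Z \<longrightarrow> fibre_product ?S (fst Z) (snd Z) ?D ?b (P Z) (p Z) (q Z)) \<and>
      (\<forall>Z. scheme_over k Z \<longrightarrow> bij_betw (\<Phi> Z) (Hom_over k Z J)
        (Hom_over k (P Z, comp_mor (P Z) (fst Z) ?S (snd Z) (p Z)) Y)) \<and>
      (\<forall>Z Z' g h u. scheme_over k Z \<and> scheme_over k Z' \<and> g \<in> Hom_over k Z' Z \<and>
        h \<in> Mor (P Z') (P Z) \<and>
        comp_mor (P Z') (P Z) (fst Z) (p Z) h = comp_mor (P Z') (fst Z') (fst Z) g (p Z') \<and>
        comp_mor (P Z') (P Z) ?D (q Z) h = q Z' \<and> u \<in> Hom_over k Z J \<longrightarrow>
        \<Phi> Z' (comp_mor (fst Z') (fst Z) (fst J) u g) = comp_mor (P Z') (P Z) (fst Y) (\<Phi> Z u) h)"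
    using jet unfolding jet_scheme_def T Let_def by (rule conjunct2)
  then obtain P :: "('p, 'r, 'k) over_Spec \<Rightarrow> ('p, 'r) rspace" and p q
    and \<Phi> :: "('p, 'r, 'k) over_Spec \<Rightarrow> ('p, 'r, 'p, 'r) mor \<Rightarrow> ('p, 'r, 'p, 'r) mor" where
    fp: "\<forall>Z. scheme_over k Z \<longrightarrow> fibre_product ?S (fst Z) (snd Z) ?D ?b (P Z) (p Z) (q Z)"
    and \<Phi>: "\<forall>Z. scheme_over k Z \<longrightarrow> bij_betw (\<Phi> Z) (Hom_over k Z J)
        (Hom_over k (P Z, comp_mor (P Z) (fst Z) ?S (snd Z) (p Z)) Y)"
    and nat: "\<forall>Z Z' g h u. scheme_over k Z \<and> scheme_over k Z' \<and> g \<in> Hom_over k Z' Z \<and>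
        h \<in> Mor (P Z') (P Z) \<and>
        comp_mor (P Z') (P Z) (fst Z) (p Z) h = comp_mor (P Z') (fst Z') (fst Z) g (p Z') \<and>
        comp_mor (P Z') (P Z) ?D (q Z) h = q Z' \<and> u \<in> Hom_over k Z J \<longrightarrow>
        \<Phi> Z' (comp_mor (fst Z') (fst Z) (fst J) u g) = comp_mor (P Z') (P Z) (fst Y) (\<Phi> Z u) h"
    by (elim exE conjE)
  note fp = fp[rule_format] and \<Phi> = \<Phi>[rule_format]
  have P: "scheme (P Z)" "locally_ringed_space (P Z)" "p Z \<in> Mor (P Z) (fst Z)" "q Z \<in> Mor (P Z) ?D"
    "comp_mor (P Z) (fst Z) ?S (snd Z) (p Z) = comp_mor (P Z) ?D ?S ?b (q Z)"
    if "scheme_over k Z" for Z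
    using fp[OF that] by (simp_all add: fibre_product_def scheme_def)
  have lift: "\<exists>!h. h \<in> Mor T (P Z) \<and> comp_mor T (P Z) (fst Z) (p Z) h = u \<and> comp_mor T (P Z) ?D (q Z) h = v"
    if "scheme_over k Z" "scheme T" "u \<in> Mor T (fst Z)" "v \<in> Mor T ?D"
      "comp_mor T (fst Z) ?S (snd Z) u = comp_mor T ?D ?S ?b v" for Z u v and T :: "('p, 'r) rspace"
    by (rule fp[OF that(1), unfolded fibre_product_def, THEN conjunct2, THEN conjunct2,
          THEN conjunct2, THEN conjunct2, rule_format]) (intro conjI that)
  note b' = Spec_hom.presheaf_mor_Spec_map[OF tr(1)] and e' = Spec_hom.presheaf_mor_Spec_map[OF tr(2)]
  let ?v = "\<lambda>Z. comp_mor (fst Z) ?S ?D ?e (snd Z)"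
  have v: "?v Z \<in> Mor (fst Z) ?D" and bv: "comp_mor (fst Z) ?D ?S ?b (?v Z) = snd Z"
    if Z: "scheme_over k Z" for Z :: "('p, 'r, 'k) over_Spec"
  proof -
    have lZ: "locally_ringed_space (fst Z)" and aZ: "snd Z \<in> Mor (fst Z) ?S"
      using Z by (simp_all add: scheme_over_def scheme_def)
    show "?v Z \<in> Mor (fst Z) ?D" by (rule Mor_comp_Spec_map_field[OF k tr(2) lZ aZ])
    have "comp_mor (fst Z) ?D ?S ?b (?v Z) = comp_mor (fst Z) ?S ?S (comp_mor ?S ?D ?S ?b ?e) (snd Z)"
      by (rule comp_mor_assoc[OF M[OF aZ] e' b', symmetric])
    also have "comp_mor ?S ?D ?S ?b ?e = id_mor ?S" by (rule comp_Spec_map_retraction[OF tr(1,2)]) (rule tr(3))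
    finally show "comp_mor (fst Z) ?D ?S ?b (?v Z) = snd Z"
      by (simp add: comp_id_left[OF M[OF aZ]])
  qed
  have sect: "\<exists>z. z \<in> Mor (fst Z) (P Z) \<and> comp_mor (fst Z) (P Z) (fst Z) (p Z) z = id_mor (fst Z) \<and>
      comp_mor (fst Z) (P Z) ?D (q Z) z = ?v Z"
    if Z: "scheme_over k Z" for Z
  proof -
    have lZ: "locally_ringed_space (fst Z)" and aZ: "snd Z \<in> Mor (fst Z) ?S"
      and sZ: "scheme (fst Z)" using Z by (simp_all add: scheme_over_def scheme_def)
    have "comp_mor (fst Z) (fst Z) ?S (snd Z) (id_mor (fst Z)) = comp_mor (fst Z) ?D ?S ?b (?v Z)"
      by (simp add: comp_id_right[OF M[OF aZ]] bv[OF Z])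
    from lift[OF Z sZ Mor_id[OF lZ] v[OF Z] this] show ?thesis by blast
  qed
  obtain zY where zY: "zY \<in> Mor (fst Y) (P Y)" "comp_mor (fst Y) (P Y) (fst Y) (p Y) zY = id_mor (fst Y)"
    "comp_mor (fst Y) (P Y) ?D (q Y) zY = ?v Y" using sect[OF sY] by blast
  obtain zJ where zJ: "zJ \<in> Mor (fst J) (P J)" "comp_mor (fst J) (P J) (fst J) (p J) zJ = id_mor (fst J)"
    "comp_mor (fst J) (P J) ?D (q J) zJ = ?v J" using sect[OF sJ] by blast
  have "p Y \<in> Hom_over k (P Y, comp_mor (P Y) (fst Y) ?S (snd Y) (p Y)) Y"
    using P[OF sY] by (simp add: Hom_over_def)
  then obtain s where s: "s \<in> Hom_over k Y J" "\<Phi> Y s = p Y"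
    using \<Phi>[OF sY] by (metis bij_betw_imp_surj_on imageE)
  then have sM: "s \<in> Mor (fst Y) (fst J)" and sO: "comp_mor (fst Y) (fst J) ?S (snd J) s = snd Y"
    by (simp_all add: Hom_over_def)
  have idJ: "id_mor (fst J) \<in> Hom_over k J J"
    using Mor_id[OF lJ] comp_id_right[OF M[OF aJ]] by (simp add: Hom_over_def)
  define ev where "ev = \<Phi> J (id_mor (fst J))"
  have ev: "ev \<in> Mor (P J) (fst Y)"
    using \<Phi>[OF sJ] idJ by (auto simp: ev_def Hom_over_def bij_betw_def)
  \<comment> \<open>The morphism \<open>h = s \<times> id\<close> comes from the universal property of \<open>J \<times> D\<close>.\<close>
  let ?u = "comp_mor (P Y) (fst Y) (fst J) s (p Y)"
  have u: "?u \<in> Mor (P Y) (fst J)"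
    by (rule Mor_comp[OF P(2)[OF sY] lY pre[OF lJ] P(3)[OF sY] sM])
  have "comp_mor (P Y) (fst J) ?S (snd J) ?u = comp_mor (P Y) ?D ?S ?b (q Y)"
    using comp_mor_assoc[OF M[OF P(3)[OF sY]] M[OF sM] M[OF aJ]] P(5)[OF sY] by (simp add: sO)
  from lift[OF sJ P(1)[OF sY] u P(4)[OF sY] this]
  obtain h where h: "h \<in> Mor (P Y) (P J)" "comp_mor (P Y) (P J) (fst J) (p J) h = ?u"
    "comp_mor (P Y) (P J) ?D (q J) h = q Y" by blast
  have "\<Phi> Y (comp_mor (fst Y) (fst J) (fst J) (id_mor (fst J)) s) = comp_mor (P Y) (P J) (fst Y) ev h"
    unfolding ev_def by (rule nat[rule_format]) (intro conjI sJ sY s(1) h idJ)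
  then have evh: "comp_mor (P Y) (P J) (fst Y) ev h = p Y"
    by (simp add: comp_id_left[OF M[OF sM]] s(2))
  \<comment> \<open>Both sides have the components \<open>s\<close> and \<open>?v Y\<close> in \<open>J \<times> D\<close>.\<close>
  have hz: "comp_mor (fst Y) (P Y) (P J) h zY = comp_mor (fst Y) (fst J) (P J) zJ s" (is "?l = ?r")
  proof -
    have l: "?l \<in> Mor (fst Y) (P J)" by (rule Mor_comp[OF lY P(2)[OF sY] pre[OF P(2)[OF sJ]] zY(1) h(1)])
    have r: "?r \<in> Mor (fst Y) (P J)" by (rule Mor_comp[OF lY lJ pre[OF P(2)[OF sJ]] sM zJ(1)])
    have pl: "comp_mor (fst Y) (P J) (fst J) (p J) ?l = s"
    proof -
      have "comp_mor (fst Y) (P J) (fst J) (p J) ?l = comp_mor (fst Y) (P Y) (fst J) ?u zY"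
        using comp_mor_assoc[OF M[OF zY(1)] M[OF h(1)] M[OF P(3)[OF sJ]]] by (simp add: h(2))
      also have "\<dots> = s"
        using comp_mor_assoc[OF M[OF zY(1)] M[OF P(3)[OF sY]] M[OF sM]]
        by (simp add: zY(2) comp_id_right[OF M[OF sM]])
      finally show ?thesis .
    qed
    have pr: "comp_mor (fst Y) (P J) (fst J) (p J) ?r = s"
      using comp_mor_assoc[OF M[OF sM] M[OF zJ(1)] M[OF P(3)[OF sJ]]]
      by (simp add: zJ(2) comp_id_left[OF M[OF sM]])
    have ql: "comp_mor (fst Y) (P J) ?D (q J) ?l = ?v Y"
      using comp_mor_assoc[OF M[OF zY(1)] M[OF h(1)] M[OF P(4)[OF sJ]]] by (simp add: h(3) zY(3))
    have "comp_mor (fst Y) (P J) ?D (q J) ?r = comp_mor (fst Y) (fst J) ?D (?v J) s"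
      using comp_mor_assoc[OF M[OF sM] M[OF zJ(1)] M[OF P(4)[OF sJ]]] by (simp add: zJ(3))
    also have "\<dots> = ?v Y"
      using comp_mor_assoc[OF M[OF sM] M[OF aJ] e'] by (simp add: sO)
    finally have qr: "comp_mor (fst Y) (P J) ?D (q J) ?r = ?v Y" .
    have schY: "scheme (fst Y)" using sY by (simp add: scheme_over_def)
    have "comp_mor (fst Y) (fst J) ?S (snd J) s = comp_mor (fst Y) ?D ?S ?b (?v Y)"
      by (simp add: sO bv[OF sY])
    from lift[OF sJ schY sM v[OF sY] this] show ?thesis
      using l r pl pr ql qr by blast
  qed
  let ?pi = "comp_mor (fst J) (P J) (fst Y) ev zJ"
  have pi: "?pi \<in> Mor (fst J) (fst Y)"
    by (rule Mor_comp[OF lJ P(2)[OF sJ] pre[OF lY] zJ(1) ev])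
  have "comp_mor (fst Y) (fst J) (fst Y) ?pi s =
      comp_mor (fst Y) (P J) (fst Y) ev (comp_mor (fst Y) (fst J) (P J) zJ s)"
    by (rule comp_mor_assoc[OF M[OF sM] M[OF zJ(1)] M[OF ev]])
  also have "\<dots> = comp_mor (fst Y) (P Y) (fst Y) (comp_mor (P Y) (P J) (fst Y) ev h) zY"
    unfolding hz[symmetric] by (rule comp_mor_assoc[OF M[OF zY(1)] M[OF h(1)] M[OF ev], symmetric])
  also have "\<dots> = id_mor (fst Y)" by (simp add: evh zY(2))
  finally show thesis
    using that[of s ?pi] lY lJ sM pi by (simp add: space_retract_def)
qed

theorem mainTheorem7:
  fixes k :: "'k ring"
    and m :: nat
    and Y J :: "('p, 'r, 'k) over_Spec"
  assumes "algebraically_closed k"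
    and "finite_type_over k Y"
    and "m \<ge> 1"
    and "jet_scheme k m Y J"
  shows "(reduced (fst J) \<longrightarrow> reduced (fst Y)) \<and>
         (connected_space (space_of (fst J)) \<longrightarrow> connected_space (space_of (fst Y))) \<and>
         (irreducible_space (space_of (fst J)) \<longrightarrow> irreducible_space (space_of (fst Y))) \<and>
         (locally_integral (fst J) \<longrightarrow> locally_integral (fst Y)) \<and>
         (locally_integral (fst J) \<and> normal_scheme (fst J) \<longrightarrow>
            locally_integral (fst Y) \<and> normal_scheme (fst Y))"
proof -
  have "field k" using assms(1) by (rule algebraically_closed.axioms)
  then obtain i r where "space_retract (fst Y) (fst J) i r"
    using jet_retract[OF _ assms(2,4)] by blast
  then interpret space_retract "fst Y" "fst J" i r .
  show ?thesis
    using reduced_base connected_base irreducible_base locally_integral_base normal_base by blast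
qed

end
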